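(* Assume $S$ is a left cancellative monoid such that $\rho_{\chi_e}$ defines an isomorphism $C^*_r(\mathcal{G}_P(S))\cong C^*_r(S)$. Then $\mathcal{G}_P(S)=\mathcal{G}(S)$.
   Context: Monoid. Let $S$ be a left cancellative monoid with identity $e$. $C^*_r(S)\subset B(\ell^2(S))$ is the C$^*$-algebra generated by the operators $\lambda_s$, $\lambda_s\delta_t=\delta_{st}$. The left inverse hull $I_\ell(S)$ is the inverse semigroup of partial bijections of $S$ generated by the left translations $t\mapsto st$ ($s\in S$); $S$ is viewed as a subset of $I_\ell(S)$, and $s^{-1}\in I_\ell(S)$ is the bijection $sS\to S$ inverse to $t\mapsto st$. $E(S)$ is the semigroup of idempotents of $I_\ell(S)$; each of them is the identity map $p_X$ on a constructible right ideal $X=s_1^{-1}t_1\dots s_n^{-1}t_nS$, and $\mathcal{J}(S)$ is the set of constructible right ideals. $\bar{\mathcal{J}}(S)$ is the collection of subsets of $S$ consisting of $\mathcal{J}(S)$ and all sets $X\setminus\bigcup_{i=1}^mX_i$ with $X,X_1,\dots,X_m\in\mathcal{J}(S)$. Groupoids. $\widehat{E(S)}$ is the compact space (topology of pointwise convergence) of not identically zero semigroup homomorphisms $E(S)\to\{0,1\}$. For $s\in S$, $\chi_s(p_X)=1$ if $s\in X$ and $0$ otherwise. The Paterson groupoid $\mathcal{G}(I_\ell(S))$ is the set of classes $[g,\chi]$ of pairs $(g,\chi)\in I_\ell(S)\times\widehat{E(S)}$ with $\chi(g^{-1}g)=1$, where $(g_1,\chi_1)$, $(g_2,\chi_2)$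 are equivalent iff $\chi_1=\chi_2$ and $g_1p=g_2p$ for some $p\in E(S)$ with $\chi_1(p)=1$. Product: $[g,\chi][h,\psi]=[gh,\psi]$ if $\chi=\psi(h^{-1}\cdot h)$; the unit space is identified with $\widehat{E(S)}$ via $\chi\mapsto[p_S,\chi]$; $s([g,\chi])=\chi$, $r([g,\chi])=\chi(g^{-1}\cdot g)$. A basis of the topology is given by the sets $D(g,U)=\{[g,\chi]:\chi\in U\}$, $U$ an open subset of $\{\chi:\chi(g^{-1}g)=1\}$. Let $\Omega(S)$ be the closure of $\{\chi_s:s\in S\}$ in $\widehat{E(S)}$ (an invariant set), and $\mathcal{G}_P(S)=\mathcal{G}(I_\ell(S))_{\Omega(S)}=r^{-1}(\Omega(S))=s^{-1}(\Omega(S))$. Each $\chi\in\Omega(S)$ extends to $\bar{\mathcal{J}}(S)$: for $X,X_i\in\mathcal{J}(S)$, $\chi(p_{X\setminus\bigcup_iX_i})=1$ if $\chi(p_X)=1$ and $\chi(p_{X_i})=0$ for all $i$, and it is $0$ otherwise. Then $\mathcal{G}(S)=\mathcal{G}_P(S)/{\sim}$ is the quotient groupoid, where $[g,\chi]\sim[h,\chi]$ iff there is $X\in\bar{\mathcal{J}}(S)$ with $\chi(p_X)=1$ and $g|_X=h|_X$. The equality $\mathcal{G}_P(S)=\mathcal{G}(S)$ means that the relation $\sim$ is trivial. Reduced C$^*$-algebra. For a locally compact étale (not necessarily Hausdorff) groupoid $\mathcal{G}$, $C_c(\mathcal{G})$ is the linear span, inside functions on $\mathcal{G}$, of $C_c(V)$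 (extended by zero) over open Hausdorff $V\subset\mathcal{G}$, with convolution $(f_1*f_2)(g)=\sum_{h\in\mathcal{G}^{r(g)}}f_1(h)f_2(h^{-1}g)$ and $f^*(g)=\overline{f(g^{-1})}$; for $x\in\mathcal{G}^{(0)}$, $\rho_x$ is the representation on $\ell^2(\mathcal{G}_x)$, $\mathcal{G}_x=s^{-1}(x)$, given by $(\rho_x(f)\xi)(g)=\sum_{h\in\mathcal{G}^{r(g)}}f(h)\xi(h^{-1}g)$, and $C^*_r(\mathcal{G})$ is the completion in $\|f\|_r=\sup_x\|\rho_x(f)\|$. For $\mathcal{G}=\mathcal{G}_P(S)$, the map $s\mapsto[s,\chi_e]$ is a bijection $S\to\mathcal{G}_{\chi_e}$, so $\rho_{\chi_e}$ is viewed as a representation on $\ell^2(S)$; it gives a surjective $*$-homomorphism $C^*_r(\mathcal{G}_P(S))\to C^*_r(S)$. *)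

theory Defs
  imports "HOL-Analysis.Analysis"
begin

class left_cancel_monoid = monoid_mult +
  assumes left_cancel: "a * b = a * c \<Longrightarrow> b = c"


section \<open>The left inverse hull and constructible ideals\<close>

type_synonym 's pmap = "'s \<Rightarrow> 's option"

definition pinv :: "'s pmap \<Rightarrow> 's pmap" where
  "pinv g = (\<lambda>y. if y \<in> ran g then Some (THE x. g x = Some y) else None)"

definition ltrans :: "'s::left_cancel_monoid \<Rightarrow> 's pmap" where
  "ltrans s = (\<lambda>t. Some (s * t))"

inductive_set inv_hull :: "('s::left_cancel_monoid pmap) set" where
  ltrans: "ltrans s \<in> inv_hull"
| pinv: "g \<in> inv_hull \<Longrightarrow> pinv g \<in> inv_hull"
| comp: "g \<in> inv_hull \<Longrightarrow> h \<in> inv_hull \<Longrightarrow> g \<circ>\<^sub>m h \<in> inv_hull"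

definition idems :: "('s::left_cancel_monoid pmap) set" where
  "idems = {p \<in> inv_hull. p \<circ>\<^sub>m p = p}"

definition pid :: "'s set \<Rightarrow> 's pmap" where
  "pid X = Some |` X"

text \<open>The set in the second clause is \<open>s\<^sup>-\<^sup>1 t X\<close>, i.e. the preimage of \<open>t X\<close> under left
  translation by \<open>s\<close>; iterating from the whole monoid yields all \<open>s\<^sub>1\<^sup>-\<^sup>1 t\<^sub>1 \<dots> s\<^sub>n\<^sup>-\<^sup>1 t\<^sub>n S\<close>.\<close>

inductive_set constr_ideals :: "('s::left_cancel_monoid set) set" where
  whole: "UNIV \<in> constr_ideals"
| step: "X \<in> constr_ideals \<Longrightarrow> {y. \<exists>x\<in>X. s * y = t * x} \<in> constr_ideals"

definition constr_diffs :: "('s::left_cancel_monoid set) set" where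
  "constr_diffs = constr_ideals \<union>
     {X - \<Union>\<F> | X \<F>. X \<in> constr_ideals \<and> finite \<F> \<and> \<F> \<noteq> {} \<and> \<F> \<subseteq> constr_ideals}"


section \<open>Characters\<close>

text \<open>Characters are extensional functions on \<open>idems\<close>, as required by the carrier of
  \<open>product_topology\<close>, which is the topology of pointwise convergence.\<close>

type_synonym 's character = "'s pmap \<Rightarrow> nat"

definition chars :: "('s::left_cancel_monoid character) set" where
  "chars = {\<phi>. \<phi> \<in> (idems \<rightarrow>\<^sub>E {0, 1}) \<and>
     (\<forall>p\<in>idems. \<forall>q\<in>idems. \<phi> (p \<circ>\<^sub>m q) = \<phi> p * \<phi> q) \<and> (\<exists>p\<in>idems. \<phi> p \<noteq> 0)}"

definition char_top :: "('s::left_cancel_monoid character) topology" where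
  "char_top = subtopology (product_topology (\<lambda>_. discrete_topology {0, 1}) idems) chars"

text \<open>Every idempotent is \<open>pid X\<close> with \<open>X\<close> its domain.\<close>

definition point_char :: "'s::left_cancel_monoid \<Rightarrow> 's character" where
  "point_char s = (\<lambda>p\<in>idems. if s \<in> dom p then 1 else 0)"

definition Omega :: "('s::left_cancel_monoid character) set" where
  "Omega = char_top closure_of (range point_char)"

text \<open>The extension of \<open>\<phi> \<in> Omega\<close> to \<open>constr_diffs\<close>. The value does not depend on how \<open>Y\<close> is
  written as a difference, since \<open>\<phi>\<close> is a limit of the characters \<open>point_char s\<close>.\<close>

definition char_ext :: "'s::left_cancel_monoid character \<Rightarrow> 's set \<Rightarrow> nat" where
  "char_ext \<phi> Y = (if \<exists>X \<F>. X \<in> constr_ideals \<and> finite \<F> \<and> \<F> \<subseteq> constr_ideals \<and>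
       Y = X - \<Union>\<F> \<and> \<phi> (pid X) = 1 \<and> (\<forall>Z\<in>\<F>. \<phi> (pid Z) = 0) then 1 else 0)"

text \<open>The character \<open>\<phi>(g\<^sup>-\<^sup>1 \<cdot> g)\<close>.\<close>

definition act :: "'s::left_cancel_monoid pmap \<Rightarrow> 's character \<Rightarrow> 's character" where
  "act g \<phi> = (\<lambda>p\<in>idems. \<phi> (pinv g \<circ>\<^sub>m p \<circ>\<^sub>m g))"


section \<open>Topological groupoids\<close>

text \<open>The unit space is kept as a separate type of points; source and range take values in it.\<close>

record ('g, 'u) groupoid =
  arrows :: "'g set"
  units :: "'u set"
  src :: "'g \<Rightarrow> 'u"
  rng :: "'g \<Rightarrow> 'u"
  gmult :: "'g \<Rightarrow> 'g \<Rightarrow> 'g"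
  ginv :: "'g \<Rightarrow> 'g"
  gtop :: "'g topology"

definition restrict_groupoid :: "('g, 'u) groupoid \<Rightarrow> 'u set \<Rightarrow> ('g, 'u) groupoid" where
  "restrict_groupoid G Y = G\<lparr>arrows := {a \<in> arrows G. src G a \<in> Y}, units := Y,
     gtop := subtopology (gtop G) {a \<in> arrows G. src G a \<in> Y}\<rparr>"


section \<open>The Paterson groupoid\<close>

type_synonym 's germ = "('s pmap \<times> 's character) set"

definition germ_pairs :: "('s::left_cancel_monoid pmap \<times> 's character) set" where
  "germ_pairs = {(g, \<phi>). g \<in> inv_hull \<and> \<phi> \<in> chars \<and> \<phi> (pinv g \<circ>\<^sub>m g) = 1}"

definition germ_rel ::
    "(('s::left_cancel_monoid pmap \<times> 's character) \<times> ('s pmap \<times> 's character)) set" where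
  "germ_rel = {((g, \<phi>), (h, \<psi>)). (g, \<phi>) \<in> germ_pairs \<and> (h, \<psi>) \<in> germ_pairs \<and>
     \<phi> = \<psi> \<and> (\<exists>p\<in>idems. \<phi> p = 1 \<and> g \<circ>\<^sub>m p = h \<circ>\<^sub>m p)}"

definition germ :: "'s::left_cancel_monoid pmap \<Rightarrow> 's character \<Rightarrow> 's germ" where
  "germ g \<phi> = germ_rel `` {(g, \<phi>)}"

text \<open>Products are only meaningful for composable arrows, i.e. when \<open>\<phi> = act h \<psi>\<close> for
  \<open>germ g \<phi>\<close> and \<open>germ h \<psi>\<close>.\<close>

definition paterson :: "('s::left_cancel_monoid germ, 's character) groupoid" where
  "paterson = \<lparr>
     arrows = germ_pairs // germ_rel,
     units = chars,
     src = (\<lambda>a. the_elem ((\<lambda>(g, \<phi>). \<phi>) ` a)),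
     rng = (\<lambda>a. the_elem ((\<lambda>(g, \<phi>). act g \<phi>) ` a)),
     gmult = (\<lambda>a b. \<Union>(g, \<phi>)\<in>a. \<Union>(h, \<psi>)\<in>b. germ (g \<circ>\<^sub>m h) \<psi>),
     ginv = (\<lambda>a. \<Union>(g, \<phi>)\<in>a. germ (pinv g) (act g \<phi>)),
     gtop = topology_generated_by
       {germ g ` U | g U. g \<in> inv_hull \<and> openin char_top U \<and>
          U \<subseteq> {\<phi> \<in> chars. \<phi> (pinv g \<circ>\<^sub>m g) = 1}}\<rparr>"

definition GP :: "('s::left_cancel_monoid germ, 's character) groupoid" where
  "GP = restrict_groupoid paterson Omega"

text \<open>The relation on \<open>GP\<close> whose quotient is the groupoid \<open>\<G>(S)\<close>.\<close>

definition GP_sim :: "('s::left_cancel_monoid germ \<times> 's germ) set" where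
  "GP_sim = {(germ g \<phi>, germ h \<phi>) | g h \<phi>. germ g \<phi> \<in> arrows GP \<and> germ h \<phi> \<in> arrows GP \<and>
     (g, \<phi>) \<in> germ_pairs \<and> (h, \<phi>) \<in> germ_pairs \<and>
     (\<exists>X\<in>constr_diffs. char_ext \<phi> X = 1 \<and> g |` X = h |` X)}"


section \<open>The Hilbert space of square summable functions\<close>

definition l2norm :: "('a \<Rightarrow> complex) \<Rightarrow> ennreal" where
  "l2norm \<xi> = (SUP F\<in>{F. finite F}. ennreal (L2_set (\<lambda>x. cmod (\<xi> x)) F))"

lemma l2norm_upper: "finite F \<Longrightarrow> ennreal (L2_set (\<lambda>x. cmod (\<xi> x)) F) \<le> l2norm \<xi>"
  unfolding l2norm_def by (rule SUP_upper) simp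

lemma l2norm_zero [simp]: "l2norm (\<lambda>_ :: 'a. 0) = 0"
proof -
  have "l2norm (\<lambda>_ :: 'a. 0) \<le> 0"
    unfolding l2norm_def by (rule SUP_least) (simp add: L2_set_def)
  then show ?thesis by simp
qed

lemma l2norm_eq_0: "l2norm \<xi> = 0 \<Longrightarrow> \<xi> x = 0"
  using l2norm_upper[of "{x}" \<xi>] by simp

lemma l2norm_triangle: "l2norm (\<lambda>x. \<xi> x + \<eta> x) \<le> l2norm \<xi> + l2norm \<eta>"
  unfolding l2norm_def[of "\<lambda>x. \<xi> x + \<eta> x"]
proof (rule SUP_least)
  fix F :: "'a set" assume "F \<in> {F. finite F}"
  then have F: "finite F" by simp
  have "L2_set (\<lambda>x. cmod (\<xi> x + \<eta> x)) F \<le> L2_set (\<lambda>x. cmod (\<xi> x) + cmod (\<eta> x)) F"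
    by (rule L2_set_mono) (auto intro: norm_triangle_ineq)
  also have "\<dots> \<le> L2_set (\<lambda>x. cmod (\<xi> x)) F + L2_set (\<lambda>x. cmod (\<eta> x)) F"
    by (rule L2_set_triangle_ineq)
  finally have "ennreal (L2_set (\<lambda>x. cmod (\<xi> x + \<eta> x)) F)
      \<le> ennreal (L2_set (\<lambda>x. cmod (\<xi> x)) F) + ennreal (L2_set (\<lambda>x. cmod (\<eta> x)) F)"
    by (simp flip: ennreal_plus add: ennreal_leI)
  also have "\<dots> \<le> l2norm \<xi> + l2norm \<eta>"
    by (intro add_mono l2norm_upper F)
  finally show "ennreal (L2_set (\<lambda>x. cmod (\<xi> x + \<eta> x)) F) \<le> l2norm \<xi> + l2norm \<eta>" .
qed

lemma l2norm_scale: "l2norm (\<lambda>x. c * \<xi> x) = ennreal (cmod c) * l2norm \<xi>"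
proof -
  have "ennreal (L2_set (\<lambda>x. cmod (c * \<xi> x)) F)
      = ennreal (cmod c) * ennreal (L2_set (\<lambda>x. cmod (\<xi> x)) F)" for F
    by (simp add: norm_mult L2_set_right_distrib flip: ennreal_mult)
  then show ?thesis
    unfolding l2norm_def by (simp add: SUP_mult_left_ennreal)
qed

typedef 'a ell2 = "{\<xi> :: 'a \<Rightarrow> complex. l2norm \<xi> < top}"
  morphisms ell2_fun Abs_ell2
  by (rule exI[of _ "\<lambda>_. 0"]) simp

setup_lifting type_definition_ell2

lemma l2norm_ell2_fun: "l2norm (ell2_fun \<xi>) < top"
  using ell2_fun by blast

lift_definition scaleC :: "complex \<Rightarrow> 'a ell2 \<Rightarrow> 'a ell2" is "\<lambda>c \<xi> x. c * \<xi> x"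
  by (simp add: l2norm_scale ennreal_mult_less_top)

instantiation ell2 :: (type) real_normed_vector
begin

lift_definition zero_ell2 :: "'a ell2" is "\<lambda>_. 0"
  by simp

lift_definition plus_ell2 :: "'a ell2 \<Rightarrow> 'a ell2 \<Rightarrow> 'a ell2" is "\<lambda>\<xi> \<eta> x. \<xi> x + \<eta> x"
  using l2norm_triangle by (metis ennreal_add_less_top le_less_trans)

lift_definition uminus_ell2 :: "'a ell2 \<Rightarrow> 'a ell2" is "\<lambda>\<xi> x. - \<xi> x"
  by (simp add: l2norm_def)

definition minus_ell2 :: "'a ell2 \<Rightarrow> 'a ell2 \<Rightarrow> 'a ell2" where
  "\<xi> - \<eta> = \<xi> + (- \<eta>)" for \<xi> \<eta> :: "'a ell2"

definition scaleR_ell2 :: "real \<Rightarrow> 'a ell2 \<Rightarrow> 'a ell2" where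
  "scaleR_ell2 r \<xi> = scaleC (complex_of_real r) \<xi>"

definition norm_ell2 :: "'a ell2 \<Rightarrow> real" where
  "norm_ell2 \<xi> = enn2real (l2norm (ell2_fun \<xi>))"

definition dist_ell2 :: "'a ell2 \<Rightarrow> 'a ell2 \<Rightarrow> real" where
  "dist_ell2 \<xi> \<eta> = norm (\<xi> - \<eta>)"

definition sgn_ell2 :: "'a ell2 \<Rightarrow> 'a ell2" where
  "sgn_ell2 \<xi> = inverse (norm \<xi>) *\<^sub>R \<xi>"

definition uniformity_ell2 :: "('a ell2 \<times> 'a ell2) filter" where
  "uniformity_ell2 = (INF e\<in>{0 <..}. principal {(\<xi>, \<eta>). dist \<xi> \<eta> < e})"

definition open_ell2 :: "'a ell2 set \<Rightarrow> bool" where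
  "open_ell2 U = (\<forall>\<xi>\<in>U. eventually (\<lambda>(\<xi>', \<eta>). \<xi>' = \<xi> \<longrightarrow> \<eta> \<in> U) uniformity)"

instance
proof
  fix a b c :: "'a ell2" and r q :: real
  show "a + b + c = a + (b + c)" by transfer (simp add: add.assoc)
  show "a + b = b + a" by transfer (simp add: add.commute)
  show "0 + a = a" by transfer simp
  show "- a + a = 0" by transfer simp
  show "a - b = a + - b" by (simp add: minus_ell2_def)
  show "r *\<^sub>R (a + b) = r *\<^sub>R a + r *\<^sub>R b"
    unfolding scaleR_ell2_def by transfer (simp add: algebra_simps)
  show "(r + q) *\<^sub>R a = r *\<^sub>R a + q *\<^sub>R a"
    unfolding scaleR_ell2_def by transfer (simp add: algebra_simps)
  show "r *\<^sub>R q *\<^sub>R a = (r * q) *\<^sub>R a"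
    unfolding scaleR_ell2_def by transfer (simp add: algebra_simps)
  show "1 *\<^sub>R a = a"
    unfolding scaleR_ell2_def by transfer simp
  show "dist a b = norm (a - b)" by (simp add: dist_ell2_def)
  show "sgn a = inverse (norm a) *\<^sub>R a" by (simp add: sgn_ell2_def)
  show "uniformity = (INF e\<in>{0 <..}. principal {(\<xi> :: 'a ell2, \<eta>). dist \<xi> \<eta> < e})"
    by (simp add: uniformity_ell2_def)
  show "open U = (\<forall>\<xi>\<in>U. eventually (\<lambda>(\<xi>', \<eta>). \<xi>' = \<xi> \<longrightarrow> \<eta> \<in> U) uniformity)"
    for U :: "'a ell2 set"
    by (simp add: open_ell2_def)
  show "norm a = 0 \<longleftrightarrow> a = 0"
  proof
    assume "norm a = 0"
    then have "l2norm (ell2_fun a) = 0"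
      using l2norm_ell2_fun[of a] unfolding norm_ell2_def enn2real_eq_0_iff
      by (metis less_irrefl)
    then have "ell2_fun a = (\<lambda>_. 0)" by (intro ext) (rule l2norm_eq_0)
    then show "a = 0" by (simp add: zero_ell2.rep_eq flip: ell2_fun_inject)
  qed (simp add: norm_ell2_def zero_ell2.rep_eq)
  show "norm (a + b) \<le> norm a + norm b"
  proof -
    have "enn2real (l2norm (ell2_fun (a + b)))
        \<le> enn2real (l2norm (ell2_fun a) + l2norm (ell2_fun b))"
      using l2norm_ell2_fun[of a] l2norm_ell2_fun[of b]
      by (intro enn2real_mono) (auto simp: plus_ell2.rep_eq l2norm_triangle)
    then show ?thesis
      using l2norm_ell2_fun[of a] l2norm_ell2_fun[of b]
      by (simp add: norm_ell2_def enn2real_plus)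
  qed
  show "norm (r *\<^sub>R a) = \<bar>r\<bar> * norm a"
    by (simp add: norm_ell2_def scaleR_ell2_def scaleC.rep_eq l2norm_scale enn2real_mult)
qed

end

lemma norm_scaleC: "norm (scaleC c \<xi>) = cmod c * norm \<xi>"
  by (simp add: norm_ell2_def scaleC.rep_eq l2norm_scale enn2real_mult)

lift_definition ell2_delta :: "'a \<Rightarrow> 'a ell2" is "\<lambda>t x. if x = t then 1 else 0"
proof -
  fix t :: 'a
  have "L2_set (\<lambda>x. cmod (if x = t then 1 else 0)) F \<le> 1" if "finite F" for F
  proof -
    have "L2_set (\<lambda>x. cmod (if x = t then 1 else 0)) F \<le> (\<Sum>x\<in>F. cmod (if x = t then 1 else 0))"
      by (rule L2_set_le_sum) simp
    also have "\<dots> = (\<Sum>x\<in>F. if x = t then 1 else 0)" by (rule sum.cong) auto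
    also have "\<dots> \<le> 1" using that by simp
    finally show ?thesis .
  qed
  then have "l2norm (\<lambda>x. if x = t then 1 else 0) \<le> ennreal 1"
    unfolding l2norm_def by (intro SUP_least ennreal_leI) simp
  then show "l2norm (\<lambda>x. if x = t then 1 else 0) < top"
    by (rule le_less_trans) simp
qed

definition cinner :: "'a ell2 \<Rightarrow> 'a ell2 \<Rightarrow> complex" where
  "cinner \<xi> \<eta> = (\<Sum>\<^sub>\<infinity>x. ell2_fun \<xi> x * cnj (ell2_fun \<eta> x))"


section \<open>Bounded operators and the reduced C*-algebra of the monoid\<close>

text \<open>\<open>blinfun\<close> consists of the bounded real-linear operators; \<open>B(\<ell>\<^sup>2)\<close> is its subset
  \<open>clinear_ops\<close>. The norm and the topology are those of \<open>blinfun\<close>.\<close>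

type_synonym 'a op = "'a ell2 \<Rightarrow>\<^sub>L 'a ell2"

definition clinear_ops :: "'a op set" where
  "clinear_ops = {T. \<forall>c \<xi>. blinfun_apply T (scaleC c \<xi>) = scaleC c (blinfun_apply T \<xi>)}"

lemma bounded_linear_scaleC_comp:
  "bounded_linear (\<lambda>\<xi>. scaleC c (blinfun_apply (T :: 'a op) \<xi>))"
proof (rule bounded_linear_compose[OF _ blinfun.bounded_linear_right])
  show "bounded_linear (scaleC c :: 'a ell2 \<Rightarrow> 'a ell2)"
  proof (rule bounded_linear_intro)
    show "scaleC c (\<xi> + \<eta>) = scaleC c \<xi> + scaleC c \<eta>" for \<xi> \<eta> :: "'a ell2"
      by transfer (simp add: algebra_simps)
    show "scaleC c (r *\<^sub>R \<xi>) = r *\<^sub>R scaleC c \<xi>" for r and \<xi> :: "'a ell2"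
      unfolding scaleR_ell2_def by transfer (simp add: algebra_simps)
    show "norm (scaleC c \<xi>) \<le> norm \<xi> * cmod c" for \<xi> :: "'a ell2"
      by (simp add: norm_scaleC mult.commute)
  qed
qed

definition op_scaleC :: "complex \<Rightarrow> 'a op \<Rightarrow> 'a op" where
  "op_scaleC c T = Blinfun (\<lambda>\<xi>. scaleC c (blinfun_apply T \<xi>))"

lemma op_scaleC_apply: "blinfun_apply (op_scaleC c T) \<xi> = scaleC c (blinfun_apply T \<xi>)"
  by (simp add: op_scaleC_def bounded_linear_Blinfun_apply bounded_linear_scaleC_comp)

definition op_adj :: "'a op \<Rightarrow> 'a op" where
  "op_adj T = (THE T'. T' \<in> clinear_ops \<and>
     (\<forall>\<xi> \<eta>. cinner (blinfun_apply T \<xi>) \<eta> = cinner \<xi> (blinfun_apply T' \<eta>)))"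

definition is_Cstar_subalgebra :: "'a op set \<Rightarrow> bool" where
  "is_Cstar_subalgebra A \<longleftrightarrow> A \<subseteq> clinear_ops \<and> A \<noteq> {} \<and> closed A \<and>
     (\<forall>T\<in>A. \<forall>R\<in>A. T + R \<in> A \<and> T o\<^sub>L R \<in> A) \<and>
     (\<forall>T\<in>A. (\<forall>c. op_scaleC c T \<in> A) \<and> op_adj T \<in> A)"

definition Cstar_generated :: "'a op set \<Rightarrow> 'a op set" where
  "Cstar_generated M = \<Inter>{A. is_Cstar_subalgebra A \<and> M \<subseteq> A}"

definition lam_fun :: "'s::left_cancel_monoid \<Rightarrow> ('s \<Rightarrow> complex) \<Rightarrow> 's \<Rightarrow> complex" where
  "lam_fun s \<xi> u = (if u \<in> range ((*) s) then \<xi> (THE t. s * t = u) else 0)"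

lemma the_left_quotient: "(THE t'. s * t' = s * t) = t" for s t :: "'s::left_cancel_monoid"
  by (rule the_equality) (auto dest: left_cancel)

lemma l2norm_lam_fun: "l2norm (lam_fun s \<xi>) \<le> l2norm \<xi>"
  unfolding l2norm_def[of "lam_fun s \<xi>"]
proof (rule SUP_least)
  fix F :: "'a set" assume "F \<in> {F. finite F}"
  then have F: "finite F" by simp
  let ?K = "(\<lambda>u. THE t. s * t = u) ` (F \<inter> range ((*) s))"
  have inj: "inj_on (\<lambda>u. THE t. s * t = u) (F \<inter> range ((*) s))"
    by (auto intro!: inj_onI simp: the_left_quotient)
  have "(\<Sum>u\<in>F. (cmod (lam_fun s \<xi> u))\<^sup>2)
      = (\<Sum>u\<in>F \<inter> range ((*) s). (cmod (\<xi> (THE t. s * t = u)))\<^sup>2)"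
    using F by (intro sum.mono_neutral_cong_right) (auto simp: lam_fun_def)
  also have "\<dots> = (\<Sum>t\<in>?K. (cmod (\<xi> t))\<^sup>2)"
    by (simp add: sum.reindex[OF inj] o_def)
  finally have "L2_set (\<lambda>x. cmod (lam_fun s \<xi> x)) F = L2_set (\<lambda>x. cmod (\<xi> x)) ?K"
    by (simp add: L2_set_def)
  then show "ennreal (L2_set (\<lambda>x. cmod (lam_fun s \<xi> x)) F) \<le> l2norm \<xi>"
    using F l2norm_upper[of ?K \<xi>] by simp
qed

lift_definition lam_ell2 :: "'s::left_cancel_monoid \<Rightarrow> 's ell2 \<Rightarrow> 's ell2" is lam_fun
  using l2norm_lam_fun le_less_trans by blast

lemma bounded_linear_lam_ell2: "bounded_linear (lam_ell2 s)"
proof (rule bounded_linear_intro)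
  show "lam_ell2 s (\<xi> + \<eta>) = lam_ell2 s \<xi> + lam_ell2 s \<eta>" for \<xi> \<eta>
    by transfer (auto simp: lam_fun_def)
  show "lam_ell2 s (r *\<^sub>R \<xi>) = r *\<^sub>R lam_ell2 s \<xi>" for r \<xi>
    unfolding scaleR_ell2_def by transfer (auto simp: lam_fun_def)
  show "norm (lam_ell2 s \<xi>) \<le> norm \<xi> * 1" for \<xi>
    using l2norm_ell2_fun[of \<xi>]
    by (auto simp: norm_ell2_def lam_ell2.rep_eq l2norm_lam_fun intro!: enn2real_mono)
qed

definition lam :: "'s::left_cancel_monoid \<Rightarrow> 's op" where
  "lam s = Blinfun (lam_ell2 s)"

lemma lam_delta: "blinfun_apply (lam s) (ell2_delta t) = ell2_delta (s * t)"
proof -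
  have "lam_ell2 s (ell2_delta t) = ell2_delta (s * t)"
    by transfer (auto simp: lam_fun_def fun_eq_iff the_left_quotient)
  then show ?thesis
    by (simp add: lam_def bounded_linear_Blinfun_apply bounded_linear_lam_ell2)
qed

record 'x star_algebra =
  scarrier :: "'x set"
  sadd :: "'x \<Rightarrow> 'x \<Rightarrow> 'x"
  sscale :: "complex \<Rightarrow> 'x \<Rightarrow> 'x"
  smult :: "'x \<Rightarrow> 'x \<Rightarrow> 'x"
  sstar :: "'x \<Rightarrow> 'x"

definition star_iso :: "'x star_algebra \<Rightarrow> 'y star_algebra \<Rightarrow> ('x \<Rightarrow> 'y) \<Rightarrow> bool" where
  "star_iso A B \<Phi> \<longleftrightarrow> bij_betw \<Phi> (scarrier A) (scarrier B) \<and>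
     (\<forall>a\<in>scarrier A. \<forall>b\<in>scarrier A.
        \<Phi> (sadd A a b) = sadd B (\<Phi> a) (\<Phi> b) \<and> \<Phi> (smult A a b) = smult B (\<Phi> a) (\<Phi> b)) \<and>
     (\<forall>a\<in>scarrier A. (\<forall>c. \<Phi> (sscale A c a) = sscale B c (\<Phi> a)) \<and>
        \<Phi> (sstar A a) = sstar B (\<Phi> a))"

definition Cstar_monoid :: "('s::left_cancel_monoid op) star_algebra" where
  "Cstar_monoid = \<lparr>scarrier = Cstar_generated (range lam),
     sadd = (+), sscale = op_scaleC, smult = (o\<^sub>L), sstar = op_adj\<rparr>"


section \<open>The reduced C*-algebra of an etale groupoid\<close>

definition Cc_on :: "('g, 'u) groupoid \<Rightarrow> 'g set \<Rightarrow> ('g \<Rightarrow> complex) set" where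
  "Cc_on G V = {f. continuous_map (subtopology (gtop G) V) euclidean f \<and>
     compactin (subtopology (gtop G) V)
       (subtopology (gtop G) V closure_of {a \<in> V. f a \<noteq> 0}) \<and>
     (\<forall>a. a \<notin> V \<longrightarrow> f a = 0)}"

definition Cc :: "('g, 'u) groupoid \<Rightarrow> ('g \<Rightarrow> complex) set" where
  "Cc G = {(\<lambda>a. \<Sum>f\<in>F. c f * f a) | F c. finite F \<and>
     F \<subseteq> \<Union>{Cc_on G V | V. openin (gtop G) V \<and> Hausdorff_space (subtopology (gtop G) V)}}"

text \<open>For \<open>f\<^sub>1 \<in> Cc G\<close> all but finitely many terms of the following sums vanish.\<close>

definition convol ::
    "('g, 'u) groupoid \<Rightarrow> ('g \<Rightarrow> complex) \<Rightarrow> ('g \<Rightarrow> complex) \<Rightarrow> 'g \<Rightarrow> complex" where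
  "convol G f\<^sub>1 f\<^sub>2 a = (if a \<in> arrows G
     then \<Sum>\<^sub>\<infinity>b\<in>{b \<in> arrows G. rng G b = rng G a}. f\<^sub>1 b * f\<^sub>2 (gmult G (ginv G b) a) else 0)"

definition involution :: "('g, 'u) groupoid \<Rightarrow> ('g \<Rightarrow> complex) \<Rightarrow> 'g \<Rightarrow> complex" where
  "involution G f a = (if a \<in> arrows G then cnj (f (ginv G a)) else 0)"

definition fibre :: "('g, 'u) groupoid \<Rightarrow> 'u \<Rightarrow> 'g set" where
  "fibre G x = {a \<in> arrows G. src G a = x}"

text \<open>Elements of \<open>\<ell>\<^sup>2(fibre G x)\<close> are represented as functions vanishing off \<open>fibre G x\<close>.\<close>

definition rho ::
    "('g, 'u) groupoid \<Rightarrow> 'u \<Rightarrow> ('g \<Rightarrow> complex) \<Rightarrow> ('g \<Rightarrow> complex) \<Rightarrow> 'g \<Rightarrow> complex" where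
  "rho G x f \<xi> a = (if a \<in> fibre G x
     then \<Sum>\<^sub>\<infinity>b\<in>{b \<in> arrows G. rng G b = rng G a}. f b * \<xi> (gmult G (ginv G b) a) else 0)"

definition rho_norm :: "('g, 'u) groupoid \<Rightarrow> 'u \<Rightarrow> ('g \<Rightarrow> complex) \<Rightarrow> ennreal" where
  "rho_norm G x f =
     (SUP \<xi>\<in>{\<xi>. (\<forall>a. a \<notin> fibre G x \<longrightarrow> \<xi> a = 0) \<and> l2norm \<xi> \<le> 1}. l2norm (rho G x f \<xi>))"

definition red_norm :: "('g, 'u) groupoid \<Rightarrow> ('g \<Rightarrow> complex) \<Rightarrow> ennreal" where
  "red_norm G f = (SUP x\<in>units G. rho_norm G x f)"

text \<open>The completion of \<open>Cc G\<close> consists of the Cauchy sequences modulo null sequences.\<close>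

definition red_Cauchy :: "('g, 'u) groupoid \<Rightarrow> (nat \<Rightarrow> 'g \<Rightarrow> complex) set" where
  "red_Cauchy G = {F. (\<forall>n. F n \<in> Cc G) \<and>
     (\<forall>e>0. \<exists>N. \<forall>m\<ge>N. \<forall>n\<ge>N. red_norm G (\<lambda>a. F m a - F n a) < ennreal e)}"

definition red_rel ::
    "('g, 'u) groupoid \<Rightarrow> ((nat \<Rightarrow> 'g \<Rightarrow> complex) \<times> (nat \<Rightarrow> 'g \<Rightarrow> complex)) set" where
  "red_rel G = {(F, H). F \<in> red_Cauchy G \<and> H \<in> red_Cauchy G \<and>
     (\<lambda>n. red_norm G (\<lambda>a. F n a - H n a)) \<longlonglongrightarrow> 0}"

definition Cstar_red :: "('g, 'u) groupoid \<Rightarrow> ((nat \<Rightarrow> 'g \<Rightarrow> complex) set) star_algebra" where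
  "Cstar_red G = \<lparr>
     scarrier = red_Cauchy G // red_rel G,
     sadd = (\<lambda>A B. \<Union>F\<in>A. \<Union>H\<in>B. red_rel G `` {\<lambda>n a. F n a + H n a}),
     sscale = (\<lambda>c A. \<Union>F\<in>A. red_rel G `` {\<lambda>n a. c * F n a}),
     smult = (\<lambda>A B. \<Union>F\<in>A. \<Union>H\<in>B. red_rel G `` {\<lambda>n. convol G (F n) (H n)}),
     sstar = (\<lambda>A. \<Union>F\<in>A. red_rel G `` {\<lambda>n. involution G (F n)})\<rparr>"

definition Cc_embed :: "('g, 'u) groupoid \<Rightarrow> ('g \<Rightarrow> complex) \<Rightarrow> (nat \<Rightarrow> 'g \<Rightarrow> complex) set" where
  "Cc_embed G f = red_rel G `` {\<lambda>_. f}"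


section \<open>The representation on the monoid\<close>

definition base_arrow :: "'s::left_cancel_monoid \<Rightarrow> 's germ" where
  "base_arrow s = germ (ltrans s) (point_char 1)"

text \<open>Transport of functions along the bijection \<open>base_arrow\<close> from the monoid onto the fibre
  of \<open>GP\<close> over \<open>point_char 1\<close>.\<close>

definition to_fibre :: "('s::left_cancel_monoid \<Rightarrow> complex) \<Rightarrow> 's germ \<Rightarrow> complex" where
  "to_fibre \<xi> a = (if a \<in> range base_arrow then \<xi> (inv base_arrow a) else 0)"

definition is_rho_e :: "('s::left_cancel_monoid germ \<Rightarrow> complex) \<Rightarrow> 's op \<Rightarrow> bool" where
  "is_rho_e f T \<longleftrightarrow> (\<forall>\<xi> s. ell2_fun (blinfun_apply T \<xi>) s
     = rho GP (point_char 1) f (to_fibre (ell2_fun \<xi>)) (base_arrow s))"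

end

theory Submission
  imports Defs
begin

text \<open>Suppose \<open>g\<close> and \<open>h\<close> agree on \<open>X - \<Union>\<F>\<close> with \<open>\<phi>(X - \<Union>\<F>) = 1\<close>, but have different germs at
  \<open>\<phi>\<close>. Let \<open>U\<close> be the compact open neighbourhood of \<open>\<phi>\<close> cut out by the domains of \<open>g\<close> and \<open>h\<close> and by
  the difference set, and let \<open>f\<close> be the indicator of the bisection \<open>D(g,U)\<close> minus that of \<open>D(h,U)\<close>.
  At a point character \<open>point_char t\<close> in \<open>U\<close> one has \<open>g t = h t\<close>, and since elements of the inverse
  hull commute with right translations, \<open>g\<close> and \<open>h\<close> then agree on \<open>tS\<close> and have the same germ there.
  The representation at \<open>point_char 1\<close> only sees \<open>f\<close> on arrows between point characters, so it kills
  \<open>f\<close>, whereas \<open>f\<close> takes the value \<open>1\<close> at the germ of \<open>g\<close> and hence has nonzero reduced norm.\<close>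

section \<open>The left inverse hull\<close>

lemma map_comp_Some: "(f \<circ>\<^sub>m g) x = Some z \<longleftrightarrow> (\<exists>y. g x = Some y \<and> f y = Some z)"
  by (auto simp: map_comp_def split: option.splits)

lemma pmap_eqI: "(\<And>x y. f x = Some y \<longleftrightarrow> g x = Some y) \<Longrightarrow> f = g"
  by (metis ext not_None_eq)

lemma map_comp_assoc: "f \<circ>\<^sub>m g \<circ>\<^sub>m h = f \<circ>\<^sub>m (g \<circ>\<^sub>m h)"
  by (rule pmap_eqI) (auto simp: map_comp_Some)

lemma pid_Some: "pid X x = Some y \<longleftrightarrow> x \<in> X \<and> y = x"
  by (auto simp: pid_def restrict_map_def)

lemma dom_pid: "dom (pid X) = X"
  by (simp add: pid_def)

text \<open>\<open>pinv\<close> is built on \<open>THE\<close>, so it inverts \<open>g\<close> only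
  if \<open>g\<close> is injective. Injectivity is a hypothesis here because
  \<open>inv_hull_inj\<close>, whose induction passes through \<open>pinv\<close>, relies on this
  lemma.\<close>

lemma pinv_Some_gen:
  assumes "\<And>x y z. g x = Some z \<Longrightarrow> g y = Some z \<Longrightarrow> x = y"
  shows "pinv g y = Some x \<longleftrightarrow> g x = Some y"
proof -
  have "(THE x. g x = Some y) = x" if "g x = Some y" for x
    using that assms by blast
  then show ?thesis
    by (auto simp: pinv_def ran_def)
qed

lemma inv_hull_inj:
  "g \<in> inv_hull \<Longrightarrow> g x = Some z \<Longrightarrow> g y = Some z \<Longrightarrow> x = y"
proof (induction arbitrary: x y z rule: inv_hull.induct)
  case (ltrans s)
  then show ?case by (auto simp: ltrans_def dest: left_cancel)
next
  case (pinv g)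
  then show ?case by (simp add: pinv_Some_gen[of g])
next
  case (comp g h)
  then show ?case by (auto simp: map_comp_Some)
qed

lemma pinv_Some: "g \<in> inv_hull \<Longrightarrow> pinv g y = Some x \<longleftrightarrow> g x = Some y"
  by (rule pinv_Some_gen) (rule inv_hull_inj)

lemma pinv_apply: "g \<in> inv_hull \<Longrightarrow> g x = Some y \<Longrightarrow> pinv g y = Some x"
  by (simp add: pinv_Some)

lemma pinv_pinv:
  assumes "g \<in> inv_hull" shows "pinv (pinv g) = g"
  using assms inv_hull.pinv[OF assms] by (intro pmap_eqI) (simp add: pinv_Some)

lemma source_comp_apply:
  assumes "g \<in> inv_hull"
  shows "(pinv g \<circ>\<^sub>m g) x = (if x \<in> dom g then Some x else None)"
  using pinv_apply[OF assms, of x] by (cases "g x") (auto simp: map_comp_def)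

lemma comp_source:
  assumes "g \<in> inv_hull" shows "g \<circ>\<^sub>m (pinv g \<circ>\<^sub>m g) = g"
proof
  fix x show "(g \<circ>\<^sub>m (pinv g \<circ>\<^sub>m g)) x = g x"
    using assms by (cases "g x") (auto simp: map_comp_def pinv_apply)
qed

text \<open>Left translations commute with right multiplication by associativity, and inverses and
  composites inherit this. Hence the value at one point \<open>t\<close> fixes a member of the hull
  on all of \<open>tS\<close>.\<close>

lemma inv_hull_equivariant:
  "g \<in> inv_hull \<Longrightarrow> g x = Some y \<Longrightarrow> g (x * z) = Some (y * z)"
proof (induction arbitrary: x y rule: inv_hull.induct)
  case (ltrans s)
  then show ?case by (auto simp: ltrans_def mult.assoc)
next
  case (pinv g)
  then show ?case by (simp add: pinv_Some)
next
  case (comp g h)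
  then show ?case by (auto simp: map_comp_Some)
qed

lemma idems_hull: "p \<in> idems \<Longrightarrow> p \<in> inv_hull"
  by (simp add: idems_def)

text \<open>If an idempotent \<open>p\<close> sends \<open>x\<close> to \<open>y\<close>, it also
  sends \<open>y\<close> to \<open>y\<close>, so injectivity forces \<open>x = y\<close>.\<close>

lemma idem_pid:
  assumes "p \<in> idems"
  obtains X where "p = pid X"
proof
  have "y = x" if "p x = Some y" for x y
  proof -
    have "(p \<circ>\<^sub>m p) x = Some y" "p \<in> inv_hull"
      using assms that by (simp_all add: idems_def)
    with that show ?thesis
      by (auto simp: map_comp_Some dest: inv_hull_inj)
  qed
  then show "p = pid (dom p)"
    by (intro pmap_eqI) (auto simp: pid_Some)
qed

lemma idemsI:
  assumes "g \<in> inv_hull" "\<And>x y. g x = Some y \<Longrightarrow> y = x"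
  shows "g \<in> idems"
proof -
  have "g = pid (dom g)"
    using assms(2) by (intro pmap_eqI) (auto simp: pid_Some)
  moreover have "pid X \<circ>\<^sub>m pid X = pid X" for X :: "'a set"
    by (rule pmap_eqI) (auto simp: map_comp_Some pid_Some)
  ultimately show ?thesis
    using assms(1) by (metis (mono_tags, lifting) idems_def mem_Collect_eq)
qed

lemma idem_comp:
  assumes "p \<in> idems" "q \<in> idems" shows "p \<circ>\<^sub>m q \<in> idems"
proof (rule idemsI)
  show "p \<circ>\<^sub>m q \<in> inv_hull"
    using assms by (intro inv_hull.comp idems_hull)
  obtain X Y where "p = pid X" "q = pid Y"
    using assms idem_pid by metis
  then show "\<And>x y. (p \<circ>\<^sub>m q) x = Some y \<Longrightarrow> y = x"
    by (auto simp: map_comp_Some pid_Some)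
qed

lemma conj_idem:
  assumes "g \<in> inv_hull" "p \<in> idems" shows "pinv g \<circ>\<^sub>m p \<circ>\<^sub>m g \<in> idems"
proof (rule idemsI)
  show "pinv g \<circ>\<^sub>m p \<circ>\<^sub>m g \<in> inv_hull"
    using assms idems_hull by (blast intro: inv_hull.comp inv_hull.pinv)
  obtain X where "p = pid X"
    using assms idem_pid by metis
  then show "\<And>x y. (pinv g \<circ>\<^sub>m p \<circ>\<^sub>m g) x = Some y \<Longrightarrow> y = x"
    using assms(1) by (auto simp: map_comp_Some pid_Some pinv_Some dest: inv_hull_inj)
qed

lemma source_idem: "g \<in> inv_hull \<Longrightarrow> pinv g \<circ>\<^sub>m g \<in> idems"
  by (rule idemsI) (auto intro: inv_hull.comp inv_hull.pinv simp: source_comp_apply split: if_splits)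

lemma range_idem: "g \<in> inv_hull \<Longrightarrow> g \<circ>\<^sub>m pinv g \<in> idems"
  using source_idem[of "pinv g"] by (simp add: pinv_pinv inv_hull.pinv)

lemma pid_UNIV_idem: "pid UNIV \<in> idems"
proof (rule idemsI)
  have "pid UNIV = ltrans (1 :: 'a)"
    by (simp add: pid_def ltrans_def restrict_map_def)
  then show "pid (UNIV :: 'a set) \<in> inv_hull"
    by (simp add: inv_hull.ltrans)
qed (simp add: pid_Some)

lemma constr_ideal_idem: "X \<in> constr_ideals \<Longrightarrow> pid X \<in> idems"
proof (induction rule: constr_ideals.induct)
  case whole
  show ?case by (rule pid_UNIV_idem)
next
  case (step X s t)
  \<comment> \<open>This is \<open>t^-1 s\<close> followed by restriction to \<open>X\<close>. Its
    domain is the new ideal, so its source idempotent is the required partial identity.\<close>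
  define g where "g = pid X \<circ>\<^sub>m (pinv (ltrans t) \<circ>\<^sub>m ltrans s)"
  have g: "g \<in> inv_hull"
    unfolding g_def using step.IH
    by (intro inv_hull.comp inv_hull.pinv inv_hull.ltrans) (rule idems_hull)
  have "g y = Some x \<longleftrightarrow> x \<in> X \<and> s * y = t * x" for x y
    unfolding g_def map_comp_Some pid_Some pinv_Some[OF inv_hull.ltrans]
    by (auto simp: ltrans_def)
  then have "dom g = {y. \<exists>x\<in>X. s * y = t * x}"
    unfolding dom_def by auto
  then have "pid {y. \<exists>x\<in>X. s * y = t * x} = pinv g \<circ>\<^sub>m g"
    using g by (auto simp: fun_eq_iff source_comp_apply pid_def restrict_map_def)
  with source_idem[OF g] show ?case by simp
qed

section \<open>Characters\<close>

lemma char_mult: "\<phi> \<in> chars \<Longrightarrow> p \<in> idems \<Longrightarrow> q \<in> idems \<Longrightarrow> \<phi> (p \<circ>\<^sub>m q) = \<phi> p * \<phi> q"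
  by (simp add: chars_def)

lemma char_01: "\<phi> \<in> chars \<Longrightarrow> p \<in> idems \<Longrightarrow> \<phi> p = 0 \<or> \<phi> p = 1"
  unfolding chars_def by (auto dest: PiE_mem)

text \<open>Inclusion of the domains means \<open>q \<circ>\<^sub>m p = p\<close>, and
  multiplicativity then gives \<open>\<phi> p = \<phi> q * \<phi> p\<close>.\<close>

lemma char_mono:
  assumes "\<phi> \<in> chars" "p \<in> idems" "q \<in> idems" "\<phi> p = 1" "dom p \<subseteq> dom q"
  shows "\<phi> q = 1"
proof -
  obtain X Y where XY: "p = pid X" "q = pid Y"
    using assms idem_pid by metis
  then have "q \<circ>\<^sub>m p = p"
    using assms(5) by (intro pmap_eqI) (auto simp: map_comp_Some pid_Some dom_pid)
  then have "\<phi> p = \<phi> q * \<phi> p"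
    using char_mult[OF assms(1,3,2)] by simp
  with assms(4) show ?thesis by simp
qed

lemma char_eq_1:
  assumes "\<phi> \<in> chars" "p \<in> idems" "\<phi> p \<noteq> 0" shows "\<phi> p = 1"
  using char_01[OF assms(1,2)] assms(3) by simp

lemma char_one:
  assumes "\<phi> \<in> chars" shows "\<phi> (pid UNIV) = 1"
proof -
  have "\<exists>p\<in>idems. \<phi> p \<noteq> 0"
    using assms by (simp only: chars_def mem_Collect_eq)
  then obtain p where p: "p \<in> idems" "\<phi> p \<noteq> 0" ..
  then have "\<phi> p = 1"
    by (rule char_eq_1[OF assms])
  then show ?thesis
    by (rule char_mono[OF assms p(1) pid_UNIV_idem]) (simp add: dom_pid)
qed

lemma point_char_apply: "p \<in> idems \<Longrightarrow> point_char s p = (if s \<in> dom p then 1 else 0)"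
  by (simp add: point_char_def)

lemma point_char_chars: "point_char s \<in> chars"
  unfolding chars_def
proof (intro CollectI conjI ballI)
  show "point_char s \<in> idems \<rightarrow>\<^sub>E {0, 1}"
    by (simp add: point_char_def)
  show "point_char s (p \<circ>\<^sub>m q) = point_char s p * point_char s q"
    if pq: "p \<in> idems" "q \<in> idems" for p q :: "'a pmap"
  proof -
    obtain X Y where "p = pid X" "q = pid Y"
      using pq idem_pid by metis
    moreover have "s \<in> dom (pid X \<circ>\<^sub>m pid Y) \<longleftrightarrow> s \<in> X \<and> s \<in> Y"
      by (simp add: pid_def map_comp_def restrict_map_def domIff)
    ultimately show ?thesis
      using idem_comp[OF pq] pq by (simp add: point_char_apply dom_pid)
  qed
  have "point_char s (pid UNIV) \<noteq> 0"
    by (simp add: point_char_apply pid_UNIV_idem dom_pid)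
  then show "\<exists>p\<in>idems. point_char s p \<noteq> 0"
    using pid_UNIV_idem by blast
qed

section \<open>Action of the inverse hull on characters\<close>

lemma germ_pairsD:
  assumes "(g, \<phi>) \<in> germ_pairs"
  shows "g \<in> inv_hull" "\<phi> \<in> chars" "\<phi> (pinv g \<circ>\<^sub>m g) = 1"
  using assms by (auto simp: germ_pairs_def)

lemma act_apply: "p \<in> idems \<Longrightarrow> act g \<phi> p = \<phi> (pinv g \<circ>\<^sub>m p \<circ>\<^sub>m g)"
  by (simp add: act_def)

text \<open>Conjugating the range idempotent by \<open>g\<close> gives back the source idempotent,
  where \<phi> is 1. This shows both that \<open>act g \<phi>\<close> is not zero and that
  \<open>pinv g\<close> is defined at it.\<close>

lemma act_range_idem:
  assumes "(g, \<phi>) \<in> germ_pairs"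
  shows "act g \<phi> (g \<circ>\<^sub>m pinv g) = 1"
proof -
  note D = germ_pairsD[OF assms]
  have "pinv g \<circ>\<^sub>m (g \<circ>\<^sub>m pinv g) \<circ>\<^sub>m g = pinv g \<circ>\<^sub>m g"
    by (simp add: map_comp_assoc comp_source D(1))
  with D show ?thesis by (simp add: act_apply range_idem)
qed

lemma act_chars:
  assumes "(g, \<phi>) \<in> germ_pairs"
  shows "act g \<phi> \<in> chars"
  unfolding chars_def
proof (intro CollectI conjI ballI)
  note D = germ_pairsD[OF assms]
  show "act g \<phi> \<in> idems \<rightarrow>\<^sub>E {0, 1}"
    using char_01[OF D(2) conj_idem[OF D(1)]] by (auto simp: act_def)
  show "act g \<phi> (p \<circ>\<^sub>m q) = act g \<phi> p * act g \<phi> q"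
    if pq: "p \<in> idems" "q \<in> idems" for p q :: "'a pmap"
  proof -
    obtain X Y where "p = pid X" "q = pid Y"
      using pq idem_pid by metis
    \<comment> \<open>Conjugation by \<open>g\<close> is multiplicative on idempotents: at a point
      of \<open>dom g\<close> both sides test whether its image lies in \<open>X\<close> and in
      \<open>Y\<close>.\<close>
    moreover have "(pinv g \<circ>\<^sub>m (pid X \<circ>\<^sub>m pid Y) \<circ>\<^sub>m g) x
        = ((pinv g \<circ>\<^sub>m pid X \<circ>\<^sub>m g) \<circ>\<^sub>m (pinv g \<circ>\<^sub>m pid Y \<circ>\<^sub>m g)) x" for x
      using pinv_apply[OF D(1), of x]
      by (cases "g x") (auto simp: map_comp_def pid_def restrict_map_def)
    ultimately have "pinv g \<circ>\<^sub>m (p \<circ>\<^sub>m q) \<circ>\<^sub>m g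
        = (pinv g \<circ>\<^sub>m p \<circ>\<^sub>m g) \<circ>\<^sub>m (pinv g \<circ>\<^sub>m q \<circ>\<^sub>m g)"
      by auto
    then show ?thesis
      using pq D by (simp add: act_apply idem_comp char_mult conj_idem)
  qed
  show "\<exists>p\<in>idems. act g \<phi> p \<noteq> 0"
    using act_range_idem[OF assms] range_idem[OF D(1)] by (intro bexI) simp_all
qed

lemma char_eqI: "\<phi> \<in> chars \<Longrightarrow> \<psi> \<in> chars \<Longrightarrow> (\<And>p. p \<in> idems \<Longrightarrow> \<phi> p = \<psi> p) \<Longrightarrow> \<phi> = \<psi>"
  by (auto simp: chars_def PiE_def intro: extensionalityI)

text \<open>The domain of the conjugated idempotent contains \<open>t\<close> exactly when the
  domain of \<open>p\<close> contains \<open>s\<close>, so the action moves points along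
  \<open>g\<close>.\<close>

lemma act_point_char:
  assumes "g \<in> inv_hull" "g t = Some s"
  shows "act g (point_char t) = point_char s"
proof -
  have "act g (point_char t) p = point_char s p" if p: "p \<in> idems" for p
  proof -
    obtain X where X: "p = pid X"
      using p idem_pid by metis
    have "pinv g s = Some t"
      using assms by (simp add: pinv_Some)
    then have "t \<in> dom (pinv g \<circ>\<^sub>m p \<circ>\<^sub>m g) \<longleftrightarrow> s \<in> dom p"
      using assms(2) by (auto simp: X map_comp_def pid_def restrict_map_def split: if_splits)
    then show ?thesis
      using assms p by (simp add: act_apply point_char_apply conj_idem)
  qed
  then show ?thesis
    by (auto simp: fun_eq_iff act_def point_char_def)
qed

lemma inverse_pair:
  assumes "(g, \<phi>) \<in> germ_pairs"
  shows "(pinv g, act g \<phi>) \<in> germ_pairs"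
  using germ_pairsD[OF assms] act_chars[OF assms] act_range_idem[OF assms]
  by (simp add: germ_pairs_def inv_hull.pinv pinv_pinv)

text \<open>The two conjugations turn \<open>p\<close> into
  \<open>p \<circ>\<^sub>m (pinv g \<circ>\<^sub>m g)\<close>, and \<phi> takes the value 1 at the
  extra factor.\<close>

lemma act_pinv_act:
  assumes "(g, \<phi>) \<in> germ_pairs"
  shows "act (pinv g) (act g \<phi>) = \<phi>"
proof (rule char_eqI)
  note D = germ_pairsD[OF assms]
  show "act (pinv g) (act g \<phi>) \<in> chars" "\<phi> \<in> chars"
    using act_chars[OF inverse_pair[OF assms]] D by auto
  fix p :: "'a pmap" assume p: "p \<in> idems"
  have i: "g \<circ>\<^sub>m p \<circ>\<^sub>m pinv g \<in> idems"
    using conj_idem[OF inv_hull.pinv[OF D(1)] p] by (simp add: pinv_pinv D)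
  have "pinv g \<circ>\<^sub>m (g \<circ>\<^sub>m p \<circ>\<^sub>m pinv g) \<circ>\<^sub>m g = p \<circ>\<^sub>m (pinv g \<circ>\<^sub>m g)"
  proof -
    obtain X where X: "p = pid X"
      using p idem_pid by metis
    have "(pinv g \<circ>\<^sub>m (g \<circ>\<^sub>m p \<circ>\<^sub>m pinv g) \<circ>\<^sub>m g) x = (p \<circ>\<^sub>m (pinv g \<circ>\<^sub>m g)) x" for x
    proof (cases "g x")
      case (Some y)
      then have "pinv g y = Some x"
        using D(1) by (simp add: pinv_Some)
      with Some show ?thesis
        by (simp add: map_comp_def X pid_def restrict_map_def)
    qed (simp add: map_comp_def)
    then show ?thesis ..
  qed
  then show "act (pinv g) (act g \<phi>) p = \<phi> p"
    using D p i by (simp add: act_apply char_mult source_idem pinv_pinv)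
qed

section \<open>Germs\<close>

lemma idem_commute:
  assumes "p \<in> idems" "q \<in> idems" shows "p \<circ>\<^sub>m q = q \<circ>\<^sub>m p"
proof -
  obtain X Y where "p = pid X" "q = pid Y"
    using assms idem_pid by metis
  then show ?thesis
    by (auto simp: fun_eq_iff map_comp_def pid_def restrict_map_def)
qed

lemma pinv_comp:
  assumes "g \<in> inv_hull" "h \<in> inv_hull"
  shows "pinv (g \<circ>\<^sub>m h) = pinv h \<circ>\<^sub>m pinv g"
  using assms
  by (intro pmap_eqI) (auto simp: pinv_Some inv_hull.comp map_comp_Some)

lemma act_comp:
  assumes "g \<in> inv_hull" "h \<in> inv_hull"
  shows "act (g \<circ>\<^sub>m h) \<psi> = act g (act h \<psi>)"
  unfolding act_def[of "g \<circ>\<^sub>m h"] act_def[of g]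
proof (rule restrict_ext)
  fix p :: "'a pmap" assume p: "p \<in> idems"
  have "pinv (g \<circ>\<^sub>m h) \<circ>\<^sub>m p \<circ>\<^sub>m (g \<circ>\<^sub>m h) = pinv h \<circ>\<^sub>m (pinv g \<circ>\<^sub>m p \<circ>\<^sub>m g) \<circ>\<^sub>m h"
    by (simp add: pinv_comp assms map_comp_assoc)
  then show "\<psi> (pinv (g \<circ>\<^sub>m h) \<circ>\<^sub>m p \<circ>\<^sub>m (g \<circ>\<^sub>m h)) = act h \<psi> (pinv g \<circ>\<^sub>m p \<circ>\<^sub>m g)"
    by (simp add: act_apply conj_idem assms p)
qed

text \<open>This makes the range of a germ well defined. Multiplying an idempotent by
  \<open>p\<close> does not change its value under \<phi>, and after this multiplication the
  conjugates by \<open>g\<close> and by \<open>h\<close> are the same map.\<close>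

lemma act_cong:
  assumes "(g, \<phi>) \<in> germ_pairs" "(h, \<phi>) \<in> germ_pairs" "p \<in> idems" "\<phi> p = 1"
    and eq: "g \<circ>\<^sub>m p = h \<circ>\<^sub>m p"
  shows "act g \<phi> = act h \<phi>"
  unfolding act_def
proof (rule restrict_ext)
  fix q :: "'a pmap" assume q: "q \<in> idems"
  note D = germ_pairsD[OF assms(1)] and D' = germ_pairsD[OF assms(2)]
  obtain X Y where XY: "p = pid X" "q = pid Y"
    using assms q idem_pid by metis
  have "((pinv g \<circ>\<^sub>m q \<circ>\<^sub>m g) \<circ>\<^sub>m p) x = ((pinv h \<circ>\<^sub>m q \<circ>\<^sub>m h) \<circ>\<^sub>m p) x" for x
  proof (cases "x \<in> X")
    case True
    then have gh: "g x = h x"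
      using fun_cong[OF eq, of x] by (simp add: XY map_comp_def pid_def)
    show ?thesis
    proof (cases "h x")
      case (Some y)
      then have "pinv g y = Some x" "pinv h y = Some x" "g x = Some y"
        using gh D(1) D'(1) by (simp_all add: pinv_apply)
      with Some show ?thesis
        by (simp add: XY map_comp_def pid_def restrict_map_def)
    qed (use gh in \<open>simp add: XY map_comp_def pid_def restrict_map_def\<close>)
  qed (simp add: XY map_comp_def pid_def)
  then have eq': "(pinv g \<circ>\<^sub>m q \<circ>\<^sub>m g) \<circ>\<^sub>m p = (pinv h \<circ>\<^sub>m q \<circ>\<^sub>m h) \<circ>\<^sub>m p" ..
  have "\<phi> (pinv k \<circ>\<^sub>m q \<circ>\<^sub>m k) = \<phi> ((pinv k \<circ>\<^sub>m q \<circ>\<^sub>m k) \<circ>\<^sub>m p)" if "k \<in> inv_hull" for k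
    by (simp only: char_mult[OF D(2) conj_idem[OF that q] assms(3)] assms(4) mult_1_right)
  from this[OF D(1)] this[OF D'(1)] show "\<phi> (pinv g \<circ>\<^sub>m q \<circ>\<^sub>m g) = \<phi> (pinv h \<circ>\<^sub>m q \<circ>\<^sub>m h)"
    unfolding eq' by (rule trans[OF _ sym])
qed

lemma germ_rel_iff:
  "((g, \<phi>), (h, \<psi>)) \<in> germ_rel \<longleftrightarrow> (g, \<phi>) \<in> germ_pairs \<and> (h, \<psi>) \<in> germ_pairs \<and>
     \<phi> = \<psi> \<and> (\<exists>p\<in>idems. \<phi> p = 1 \<and> g \<circ>\<^sub>m p = h \<circ>\<^sub>m p)"
  by (simp add: germ_rel_def)

lemma equiv_germ_rel: 
  "equiv (germ_pairs :: ('s::left_cancel_monoid pmap \<times> 's character) set) germ_rel"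
  (is "equiv ?P ?R")
proof (rule equivI)
  show "?R \<subseteq> ?P \<times> ?P"
    by (auto simp: germ_rel_def)
  show "refl_on ?P ?R"
  proof (rule refl_onI)
    fix a :: "'s pmap \<times> 's character" assume "a \<in> germ_pairs"
    moreover obtain g \<phi> where a: "a = (g, \<phi>)" by fastforce
    ultimately have g: "(g, \<phi>) \<in> germ_pairs" by simp
    then show "(a, a) \<in> germ_rel"
      unfolding a germ_rel_iff
      by (intro conjI refl bexI[of _ "pinv g \<circ>\<^sub>m g"] germ_pairsD[OF g] source_idem)
  qed
  show "sym ?R"
  proof (rule symI)
    fix a b :: "'s pmap \<times> 's character"
    assume "(a, b) \<in> germ_rel"
    moreover obtain g \<phi> h \<psi> where ab: "a = (g, \<phi>)" "b = (h, \<psi>)" by fastforce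
    ultimately show "(b, a) \<in> germ_rel"
      unfolding ab germ_rel_iff by metis
  qed
  show "trans ?R"
  proof (rule transI)
    fix a b c :: "'s pmap \<times> 's character"
    assume ab: "(a, b) \<in> germ_rel" and bc: "(b, c) \<in> germ_rel"
    obtain g \<phi> h \<psi> k \<theta> where abc: "a = (g, \<phi>)" "b = (h, \<psi>)" "c = (k, \<theta>)"
      by fastforce
    then have "\<psi> = \<phi>" "\<theta> = \<phi>"
      using ab bc by (simp_all add: germ_rel_iff)
    note eqs = abc[unfolded this]
    obtain p where p: "p \<in> idems" "\<phi> p = 1" "g \<circ>\<^sub>m p = h \<circ>\<^sub>m p"
      using ab unfolding eqs germ_rel_iff by blast
    obtain q where q: "q \<in> idems" "\<phi> q = 1" "h \<circ>\<^sub>m q = k \<circ>\<^sub>m q"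
      using bc unfolding eqs germ_rel_iff by blast
    \<comment> \<open>The composite of the two witnesses serves for transitivity: idempotents
      commute, so either of them can be moved next to \<open>h\<close>.\<close>
    have "g \<circ>\<^sub>m (p \<circ>\<^sub>m q) = (h \<circ>\<^sub>m p) \<circ>\<^sub>m q"
      by (simp only: p(3) flip: map_comp_assoc)
    also have "\<dots> = (h \<circ>\<^sub>m q) \<circ>\<^sub>m p"
      by (simp only: map_comp_assoc idem_commute[OF p(1) q(1)])
    also have "\<dots> = k \<circ>\<^sub>m (p \<circ>\<^sub>m q)"
      by (simp only: q(3)) (simp only: map_comp_assoc idem_commute[OF p(1) q(1)])
    finally have *: "g \<circ>\<^sub>m (p \<circ>\<^sub>m q) = k \<circ>\<^sub>m (p \<circ>\<^sub>m q)" .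
    have pairs: "(g, \<phi>) \<in> germ_pairs" "(k, \<phi>) \<in> germ_pairs"
      using ab bc by (simp_all add: eqs germ_rel_iff)
    have "\<phi> (p \<circ>\<^sub>m q) = 1"
      by (simp only: char_mult[OF germ_pairsD(2)[OF pairs(1)] p(1) q(1)] p(2) q(2) mult_1)
    with * pairs idem_comp[OF p(1) q(1)] show "(a, c) \<in> germ_rel"
      unfolding eqs germ_rel_iff by blast
  qed
qed

lemma germ_eq_iff_rel:
  assumes "(g, \<phi>) \<in> germ_pairs" "(h, \<psi>) \<in> germ_pairs"
  shows "germ g \<phi> = germ h \<psi> \<longleftrightarrow> ((g, \<phi>), (h, \<psi>)) \<in> germ_rel"
  unfolding germ_def by (rule eq_equiv_class_iff[OF equiv_germ_rel assms])

lemma germ_eqI: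
  assumes "(g, \<phi>) \<in> germ_pairs" "(h, \<phi>) \<in> germ_pairs" "p \<in> idems" "\<phi> p = 1" "g \<circ>\<^sub>m p = h \<circ>\<^sub>m p"
  shows "germ g \<phi> = germ h \<phi>"
  unfolding germ_eq_iff_rel[OF assms(1,2)] germ_rel_iff
  by (intro conjI refl assms bexI[OF _ assms(3)])

lemma germ_eqE:
  assumes "germ g \<phi> = germ h \<psi>" "(g, \<phi>) \<in> germ_pairs" "(h, \<psi>) \<in> germ_pairs"
  obtains p where "\<phi> = \<psi>" "p \<in> idems" "\<phi> p = 1" "g \<circ>\<^sub>m p = h \<circ>\<^sub>m p"
proof -
  have "((g, \<phi>), (h, \<psi>)) \<in> germ_rel"
    using assms(1) by (simp only: germ_eq_iff_rel[OF assms(2,3)])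
  then have "\<phi> = \<psi> \<and> (\<exists>p\<in>idems. \<phi> p = 1 \<and> g \<circ>\<^sub>m p = h \<circ>\<^sub>m p)"
    unfolding germ_rel_iff by (elim conjE) (intro conjI)
  with that show ?thesis by blast
qed

lemma germ_memD:
  assumes "(h, \<psi>) \<in> germ g \<phi>"
  shows "\<psi> = \<phi>" "(g, \<phi>) \<in> germ_pairs" "(h, \<phi>) \<in> germ_pairs" "germ g \<phi> = germ h \<phi>"
proof -
  have r: "((g, \<phi>), (h, \<psi>)) \<in> germ_rel"
    using assms by (simp only: germ_def Image_singleton_iff)
  note P = r[unfolded germ_rel_iff]
  show \<psi>: "\<psi> = \<phi>"
    by (rule P[THEN conjunct2, THEN conjunct2, THEN conjunct1, symmetric])
  show g: "(g, \<phi>) \<in> germ_pairs" and h: "(h, \<phi>) \<in> germ_pairs"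
    using P \<psi> by blast+
  from r show "germ g \<phi> = germ h \<phi>"
    by (simp only: germ_eq_iff_rel[OF g h] \<psi>)
qed

lemma germ_self: "(g, \<phi>) \<in> germ_pairs \<Longrightarrow> (g, \<phi>) \<in> germ g \<phi>"
  unfolding germ_def by (rule equiv_class_self[OF equiv_germ_rel])

text \<open>The structure maps of \<open>paterson\<close> range over all representatives of a germ.
  A function that is constant on representatives has a singleton image, which evaluates
  \<open>the_elem\<close> and the unions in those definitions.\<close>

lemma image_germ:
  assumes "(g, \<phi>) \<in> germ_pairs" "\<And>h. (h, \<phi>) \<in> germ_pairs \<Longrightarrow> germ g \<phi> = germ h \<phi> \<Longrightarrow> f (h, \<phi>) = c"
  shows "f ` germ g \<phi> = {c}"
proof -
  have "f z = c" if z: "z \<in> germ g \<phi>" for z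
  proof -
    obtain h \<psi> where hz: "z = (h, \<psi>)" by fastforce
    note m = germ_memD[OF z[unfolded hz]]
    show ?thesis
      unfolding hz m(1) by (rule assms(2)[OF m(3,4)])
  qed
  moreover have "germ g \<phi> \<noteq> {}"
    using germ_self[OF assms(1)] by blast
  ultimately show ?thesis by (simp add: image_constant_conv cong: image_cong_simp)
qed

section \<open>Structure maps of the groupoid computed on germs\<close>

lemma src_germ:
  assumes "(g, \<phi>) \<in> germ_pairs" shows "src paterson (germ g \<phi>) = \<phi>"
proof -
  have "(\<lambda>(g, \<phi>). \<phi>) ` germ g \<phi> = {\<phi>}"
    by (rule image_germ[OF assms]) simp
  then show ?thesis by (simp add: paterson_def)
qed

lemma rng_germ:
  assumes "(g, \<phi>) \<in> germ_pairs" shows "rng paterson (germ g \<phi>) = act g \<phi>"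
proof -
  have "(\<lambda>(g, \<phi>). act g \<phi>) ` germ g \<phi> = {act g \<phi>}"
  proof (rule image_germ[OF assms])
    fix h assume h: "(h, \<phi>) \<in> germ_pairs" "germ g \<phi> = germ h \<phi>"
    obtain p where "p \<in> idems" "\<phi> p = 1" "g \<circ>\<^sub>m p = h \<circ>\<^sub>m p"
      using h(2) assms h(1) by (rule germ_eqE)
    then have "act g \<phi> = act h \<phi>"
      by (rule act_cong[OF assms h(1)])
    then show "(case (h, \<phi>) of (g, \<phi>) \<Rightarrow> act g \<phi>) = act g \<phi>" by simp
  qed
  then show ?thesis by (simp add: paterson_def)
qed

lemma comp_pair:
  assumes "(g, act h \<psi>) \<in> germ_pairs" "(h, \<psi>) \<in> germ_pairs"
  shows "(g \<circ>\<^sub>m h, \<psi>) \<in> germ_pairs"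
proof -
  note D = germ_pairsD[OF assms(1)] and D' = germ_pairsD[OF assms(2)]
  have "pinv (g \<circ>\<^sub>m h) \<circ>\<^sub>m (g \<circ>\<^sub>m h) = pinv h \<circ>\<^sub>m (pinv g \<circ>\<^sub>m g) \<circ>\<^sub>m h"
    using D(1) D'(1) by (simp add: pinv_comp map_comp_assoc)
  moreover have "act h \<psi> (pinv g \<circ>\<^sub>m g) = \<psi> (pinv h \<circ>\<^sub>m (pinv g \<circ>\<^sub>m g) \<circ>\<^sub>m h)"
    by (rule act_apply[OF source_idem[OF D(1)]])
  ultimately have "\<psi> (pinv (g \<circ>\<^sub>m h) \<circ>\<^sub>m (g \<circ>\<^sub>m h)) = 1"
    using D(3) by metis
  with D D' show ?thesis by (simp add: germ_pairs_def inv_hull.comp)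
qed

lemma germ_comp_cong:
  assumes gh: "(g, act h \<psi>) \<in> germ_pairs" "(h, \<psi>) \<in> germ_pairs"
    and gh': "(g', act h \<psi>) \<in> germ_pairs" "(h', \<psi>) \<in> germ_pairs"
    and eq: "germ g (act h \<psi>) = germ g' (act h \<psi>)" "germ h \<psi> = germ h' \<psi>"
  shows "germ (g \<circ>\<^sub>m h) \<psi> = germ (g' \<circ>\<^sub>m h') \<psi>"
proof -
  obtain p where p: "p \<in> idems" "act h \<psi> p = 1" "g \<circ>\<^sub>m p = g' \<circ>\<^sub>m p"
    using eq(1) gh(1) gh'(1) by (rule germ_eqE)
  obtain q where q: "q \<in> idems" "\<psi> q = 1" "h \<circ>\<^sub>m q = h' \<circ>\<^sub>m q"
    using eq(2) gh(2) gh'(2) by (rule germ_eqE)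
  have act: "act h' \<psi> = act h \<psi>"
    using act_cong[OF gh(2) gh'(2) q] by simp
  \<comment> \<open>\<open>c\<close> pulls the domain of \<open>p\<close> back along
    \<open>h\<close>. On the domain of \<open>c \<circ>\<^sub>m q\<close> the maps \<open>h\<close>
    and \<open>h'\<close> agree, and their values lie where \<open>g\<close> and \<open>g'\<close>
    agree.\<close>
  define c where "c = pinv h \<circ>\<^sub>m p \<circ>\<^sub>m h"
  have c: "c \<in> idems" "\<psi> c = 1"
    using p germ_pairsD(1)[OF gh(2)] by (simp_all add: c_def conj_idem act_apply)
  obtain X Y where XY: "p = pid X" "q = pid Y"
    using p q idem_pid by metis
  have "((g \<circ>\<^sub>m h) \<circ>\<^sub>m (c \<circ>\<^sub>m q)) x = ((g' \<circ>\<^sub>m h') \<circ>\<^sub>m (c \<circ>\<^sub>m q)) x" for x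
  proof (cases "x \<in> Y")
    case True
    then have h: "h x = h' x"
      using fun_cong[OF q(3), of x] by (simp add: XY map_comp_def pid_def)
    show ?thesis
    proof (cases "h x")
      case (Some y)
      then have y: "pinv h y = Some x"
        using germ_pairsD(1)[OF gh(2)] by (simp add: pinv_apply)
      show ?thesis
        using True Some h y fun_cong[OF p(3), of y]
        by (auto simp: XY c_def map_comp_def pid_def restrict_map_def)
    qed (use True in \<open>simp add: XY c_def map_comp_def pid_def\<close>)
  qed (simp add: XY map_comp_def pid_def)
  then have "(g \<circ>\<^sub>m h) \<circ>\<^sub>m (c \<circ>\<^sub>m q) = (g' \<circ>\<^sub>m h') \<circ>\<^sub>m (c \<circ>\<^sub>m q)" ..
  moreover have "\<psi> (c \<circ>\<^sub>m q) = 1"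
    by (simp only: char_mult[OF germ_pairsD(2)[OF gh(2)] c(1) q(1)] c(2) q(2) mult_1)
  moreover have "(g \<circ>\<^sub>m h, \<psi>) \<in> germ_pairs" "(g' \<circ>\<^sub>m h', \<psi>) \<in> germ_pairs"
    using comp_pair[OF gh] comp_pair[of g' h' \<psi>] gh' by (simp_all add: act)
  ultimately show ?thesis
    using idem_comp[OF c(1) q(1)] by (intro germ_eqI)
qed

lemma gmult_germ:
  assumes "(g, act h \<psi>) \<in> germ_pairs" "(h, \<psi>) \<in> germ_pairs"
  shows "gmult paterson (germ g (act h \<psi>)) (germ h \<psi>) = germ (g \<circ>\<^sub>m h) \<psi>"
proof -
  have "(\<lambda>(g', \<phi>'). \<Union>(h', \<psi>')\<in>germ h \<psi>. germ (g' \<circ>\<^sub>m h') \<psi>') ` germ g (act h \<psi>)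
      = {germ (g \<circ>\<^sub>m h) \<psi>}"
  proof (rule image_germ[OF assms(1)])
    fix g' assume g': "(g', act h \<psi>) \<in> germ_pairs" "germ g (act h \<psi>) = germ g' (act h \<psi>)"
    have "(\<lambda>(h', \<psi>'). germ (g' \<circ>\<^sub>m h') \<psi>') ` germ h \<psi> = {germ (g \<circ>\<^sub>m h) \<psi>}"
      by (rule image_germ[OF assms(2)]) (simp only: germ_comp_cong[OF assms g'(1) _ g'(2)] prod.case)
    then show "(case (g', act h \<psi>) of
        (g', \<phi>') \<Rightarrow> \<Union>(h', \<psi>')\<in>germ h \<psi>. germ (g' \<circ>\<^sub>m h') \<psi>') = germ (g \<circ>\<^sub>m h) \<psi>"
      by (simp only: prod.case ccpo_Sup_singleton)
  qed
  then show ?thesis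
    by (simp only: paterson_def groupoid.simps ccpo_Sup_singleton)
qed

lemma germ_pinv_cong:
  assumes g: "(g, \<phi>) \<in> germ_pairs" and h: "(h, \<phi>) \<in> germ_pairs"
    and eq: "germ g \<phi> = germ h \<phi>"
  shows "germ (pinv g) (act g \<phi>) = germ (pinv h) (act h \<phi>)"
proof -
  obtain p where p: "p \<in> idems" "\<phi> p = 1" "g \<circ>\<^sub>m p = h \<circ>\<^sub>m p"
    using eq g h by (rule germ_eqE)
  note act = act_cong[OF g h p]
  note D = germ_pairsD[OF g] and D' = germ_pairsD[OF h]
  \<comment> \<open>This is the partial identity on the image under \<open>g\<close> of the domain
    of \<open>p\<close>. There \<open>pinv g\<close> and \<open>pinv h\<close> lead back to the same
    point, since \<open>g\<close> and \<open>h\<close> agree on the domain of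
    \<open>p\<close>.\<close>
  define q where "q = g \<circ>\<^sub>m p \<circ>\<^sub>m pinv g"
  have q: "q \<in> idems"
    using conj_idem[OF inv_hull.pinv[OF D(1)] p(1)] by (simp add: q_def pinv_pinv D)
  have "pinv g \<circ>\<^sub>m q \<circ>\<^sub>m g = (pinv g \<circ>\<^sub>m g) \<circ>\<^sub>m (p \<circ>\<^sub>m (pinv g \<circ>\<^sub>m g))"
    by (simp add: q_def map_comp_assoc)
  then have "act g \<phi> q = \<phi> ((pinv g \<circ>\<^sub>m g) \<circ>\<^sub>m (p \<circ>\<^sub>m (pinv g \<circ>\<^sub>m g)))"
    by (simp only: act_apply[OF q])
  also have "\<dots> = 1"
    using source_idem[OF D(1)]
    by (simp only: char_mult[OF D(2)] idem_comp p(1,2) D(3) mult_1)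
  finally have q1: "act g \<phi> q = 1" .
  obtain X where X: "p = pid X"
    using p idem_pid by metis
  have gh: "g x = h x" if "x \<in> X" for x
    using fun_cong[OF p(3), of x] that by (simp add: X map_comp_def pid_def)
  have "(pinv g \<circ>\<^sub>m q) y = (pinv h \<circ>\<^sub>m q) y" for y
  proof (cases "\<exists>x\<in>X. g x = Some y")
    case True
    then obtain x where x: "x \<in> X" "g x = Some y" by blast
    then have "pinv g y = Some x" "pinv h y = Some x"
      using gh[OF x(1)] by (auto intro!: pinv_apply D(1) D'(1))
    with x show ?thesis
      by (simp add: q_def X map_comp_def pid_def)
  next
    case False
    then have "q y \<noteq> Some z" for z
      unfolding q_def map_comp_Some X pid_Some pinv_Some[OF D(1)] by blast
    then have "q y = None" by (cases "q y") auto
    then show ?thesis by (simp add: map_comp_def)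
  qed
  then have "pinv g \<circ>\<^sub>m q = pinv h \<circ>\<^sub>m q" ..
  then show ?thesis
    unfolding act[symmetric]
    by (intro germ_eqI[OF inverse_pair[OF g] inverse_pair[OF h, folded act] q q1])
qed

lemma ginv_germ:
  assumes "(g, \<phi>) \<in> germ_pairs"
  shows "ginv paterson (germ g \<phi>) = germ (pinv g) (act g \<phi>)"
proof -
  have "(\<lambda>(h, \<psi>). germ (pinv h) (act h \<psi>)) ` germ g \<phi> = {germ (pinv g) (act g \<phi>)}"
    by (rule image_germ[OF assms]) (simp only: germ_pinv_cong[OF assms] prod.case)
  then show ?thesis
    by (simp only: paterson_def groupoid.simps ccpo_Sup_singleton)
qed

text \<open>Products \<open>b^-1 a\<close> of arrows with a common range are the ones that occur in
  \<open>rho\<close>; equality of the two actions is their composability.\<close>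

lemma gmult_ginv_germ:
  assumes "(g, \<phi>) \<in> germ_pairs" "(h, \<psi>) \<in> germ_pairs" "act g \<phi> = act h \<psi>"
  shows "gmult paterson (ginv paterson (germ g \<phi>)) (germ h \<psi>) = germ (pinv g \<circ>\<^sub>m h) \<psi>"
    and "(pinv g \<circ>\<^sub>m h, \<psi>) \<in> germ_pairs"
  using inverse_pair[OF assms(1)] assms(2) gmult_germ[of "pinv g" h \<psi>] comp_pair[of "pinv g" h \<psi>]
  by (simp_all add: ginv_germ assms(1,3))

text \<open>Groupoid cancellation: \<open>b^-1 a = a^-1 a\<close> forces \<open>b = a\<close>, with
  \<open>b\<close> the germ of \<open>g\<close> and \<open>a\<close> the germ of \<open>h\<close>.
  It isolates a single term of the convolution sum in \<open>red_norm_eq_0\<close>.\<close>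

lemma germ_left_cancel:
  assumes g: "(g, \<phi>) \<in> germ_pairs" and h: "(h, \<psi>) \<in> germ_pairs"
    and act: "act g \<phi> = act h \<psi>"
    and eq: "germ (pinv g \<circ>\<^sub>m h) \<psi> = germ (pinv h \<circ>\<^sub>m h) \<psi>"
  shows "germ g \<phi> = germ h \<psi>"
proof -
  note D = germ_pairsD[OF g] and D' = germ_pairsD[OF h]
  note pairs = gmult_ginv_germ(2)[OF g h act] gmult_ginv_germ(2)[OF h h refl]
  obtain p where p: "p \<in> idems" "\<psi> p = 1" "(pinv g \<circ>\<^sub>m h) \<circ>\<^sub>m p = (pinv h \<circ>\<^sub>m h) \<circ>\<^sub>m p"
    using eq pairs by (rule germ_eqE)
  \<comment> \<open>The sources are compared first: equal germs have equal ranges, and the ranges of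
    the two products are \<phi> and \<psi>.\<close>
  have "\<phi> = act (pinv g \<circ>\<^sub>m h) \<psi>"
    using act_pinv_act[OF g] by (simp add: act_comp D D' inv_hull.pinv act)
  also have "\<dots> = \<psi>"
    using act_cong[OF pairs p] act_pinv_act[OF h] by (simp add: act_comp D D' inv_hull.pinv)
  finally have \<phi>: "\<phi> = \<psi>" .
  \<comment> \<open>Cutting \<open>p\<close> down to the domain of \<open>h\<close> makes
    \<open>h x\<close> defined. The equation for \<open>p\<close> then says that
    \<open>pinv g\<close> sends \<open>h x\<close> to \<open>x\<close>, that is,
    \<open>g x = h x\<close>.\<close>
  define q where "q = p \<circ>\<^sub>m (pinv h \<circ>\<^sub>m h)"
  have q: "q \<in> idems" "\<psi> q = 1"
    using p D' by (simp_all add: q_def idem_comp source_idem char_mult)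
  obtain X where X: "p = pid X"
    using p idem_pid by metis
  have "(g \<circ>\<^sub>m q) x = (h \<circ>\<^sub>m q) x" for x
  proof (cases "x \<in> X \<and> x \<in> dom h")
    case True
    then obtain y where y: "h x = Some y" "x \<in> X" by blast
    then have "pinv g y = Some x"
      using fun_cong[OF p(3), of x] pinv_apply[OF D'(1), of x]
      by (simp add: X map_comp_def pid_def)
    then have "g x = Some y"
      by (simp add: pinv_Some D)
    with y show ?thesis
      using source_comp_apply[OF D'(1), of x]
      by (simp add: q_def X map_comp_def pid_def)
  next
    case False
    then have "q x = None"
      using source_comp_apply[OF D'(1), of x]
      by (auto simp: q_def X map_comp_def pid_def restrict_map_def split: option.splits if_splits)
    then show ?thesis by (simp add: map_comp_def)
  qed
  then have "g \<circ>\<^sub>m q = h \<circ>\<^sub>m q" ..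
  with q g h show ?thesis
    unfolding \<phi> by (intro germ_eqI)
qed

section \<open>Compact open bisections\<close>

lemma char_eq_preimage:
  assumes "p \<in> idems"
  shows "openin (product_topology (\<lambda>_. discrete_topology {0, 1}) idems)
      {\<phi> \<in> idems \<rightarrow>\<^sub>E {0, 1}. \<phi> p = (c :: nat)}" (is "openin ?P ?E")
    and "closedin (product_topology (\<lambda>_. discrete_topology {0, 1}) idems)
      {\<phi> \<in> idems \<rightarrow>\<^sub>E {0, 1}. \<phi> p = c}"
proof -
  have E: "?E = {\<phi> \<in> topspace ?P. \<phi> p \<in> {c} \<inter> {0, 1}}"
    using PiE_mem[OF _ assms] by (auto simp: topspace_product_topology)
  have cont: "continuous_map ?P (discrete_topology {0, 1}) (\<lambda>\<phi>. \<phi> p)"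
    using assms by (rule continuous_map_product_projection)
  show "openin ?P ?E"
    unfolding E by (rule openin_continuous_map_preimage[OF cont]) simp
  show "closedin ?P ?E"
    unfolding E by (rule closedin_continuous_map_preimage[OF cont]) simp
qed

lemma chars_subset: "chars \<subseteq> idems \<rightarrow>\<^sub>E {0, 1}"
  by (rule subsetI) (simp only: chars_def mem_Collect_eq)

lemma topspace_char_top: "topspace char_top = chars"
  unfolding char_top_def topspace_subtopology topspace_product_topology topspace_discrete_topology
  by (rule Int_absorb1[OF chars_subset])

lemma char_eq_clopen:
  assumes "p \<in> idems"
  shows "openin char_top {\<phi> \<in> chars. \<phi> p = c}" "closedin char_top {\<phi> \<in> chars. \<phi> p = c}"
proof -
  have "{\<phi> \<in> chars. \<phi> p = c} = {\<phi> \<in> idems \<rightarrow>\<^sub>E {0, 1}. \<phi> p = c} \<inter> chars"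
    using chars_subset by blast
  then show "openin char_top {\<phi> \<in> chars. \<phi> p = c}" "closedin char_top {\<phi> \<in> chars. \<phi> p = c}"
    using char_eq_preimage[OF assms, of c]
    unfolding char_top_def openin_subtopology closedin_subtopology by blast+
qed

text \<open>Each defining condition should involve only finitely many coordinates, hence be closed
  in the product. Being nonzero is an existential condition, so it is replaced by the value 1 at
  \<open>pid UNIV\<close>.\<close>

lemma closedin_chars:
  "closedin (product_topology (\<lambda>_. discrete_topology {0, 1}) idems) chars" (is "closedin ?P _")
proof -
  define K :: "'a character set" where "K = idems \<rightarrow>\<^sub>E {0, 1}"
  define E where "E p c = {\<phi> \<in> K. \<phi> p = c}" for p c
  \<comment> \<open>The multiplicativity equation for values in \<open>{0, 1}\<close>, written as a
    finite union of sets with prescribed coordinates: all values 1, or a zero product with one zero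
    factor.\<close>
  define M where "M p q = (E (p \<circ>\<^sub>m q) 1 \<inter> E p 1 \<inter> E q 1) \<union> (E (p \<circ>\<^sub>m q) 0 \<inter> E p 0)
      \<union> (E (p \<circ>\<^sub>m q) 0 \<inter> E q 0)" for p q
  have K: "\<phi> \<in> K \<Longrightarrow> p \<in> idems \<Longrightarrow> \<phi> p \<in> {0, 1}" for \<phi> p
    unfolding K_def by (erule (1) PiE_mem)
  have closed_E: "closedin ?P (E p c)" if "p \<in> idems" for p c
    unfolding E_def K_def using that by (rule char_eq_preimage)
  have bits: "(c = 1 \<and> a = 1 \<and> b = 1) \<or> (c = 0 \<and> a = 0) \<or> (c = 0 \<and> b = 0) \<longleftrightarrow> c = a * b"
    if "a \<in> {0, 1}" "b \<in> {0, 1}" for a b c :: nat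
    using that by auto
  have M: "\<phi> \<in> M p q \<longleftrightarrow> \<phi> \<in> K \<and> \<phi> (p \<circ>\<^sub>m q) = \<phi> p * \<phi> q"
    if "p \<in> idems" "q \<in> idems" for \<phi> p q
  proof (cases "\<phi> \<in> K")
    case True
    then have "\<phi> \<in> M p q \<longleftrightarrow> (\<phi> (p \<circ>\<^sub>m q) = 1 \<and> \<phi> p = 1 \<and> \<phi> q = 1) \<or>
        (\<phi> (p \<circ>\<^sub>m q) = 0 \<and> \<phi> p = 0) \<or> (\<phi> (p \<circ>\<^sub>m q) = 0 \<and> \<phi> q = 0)"
      unfolding M_def E_def by (simp only: Un_iff Int_iff mem_Collect_eq simp_thms disj_assoc conj_assoc)
    then show ?thesis
      unfolding bits[OF K[OF True that(1)] K[OF True that(2)]] using True by (simp only: simp_thms)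
  next
    case False
    then show ?thesis
      unfolding M_def E_def by blast
  qed
  have "\<phi> \<in> chars \<longleftrightarrow> \<phi> \<in> E (pid UNIV) 1 \<and> (\<forall>p\<in>idems. \<forall>q\<in>idems. \<phi> \<in> M p q)" for \<phi>
  proof
    assume \<phi>: "\<phi> \<in> chars"
    with chars_subset have "\<phi> \<in> K"
      unfolding K_def by (rule subsetD)
    then show "\<phi> \<in> E (pid UNIV) 1 \<and> (\<forall>p\<in>idems. \<forall>q\<in>idems. \<phi> \<in> M p q)"
      unfolding E_def using char_one[OF \<phi>] char_mult[OF \<phi>] M by (intro conjI ballI) simp_all
  next
    assume \<phi>: "\<phi> \<in> E (pid UNIV) 1 \<and> (\<forall>p\<in>idems. \<forall>q\<in>idems. \<phi> \<in> M p q)"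
    then have "\<phi> \<in> K" "\<phi> (pid UNIV) \<noteq> 0"
      unfolding E_def by simp_all
    moreover have "\<forall>p\<in>idems. \<forall>q\<in>idems. \<phi> (p \<circ>\<^sub>m q) = \<phi> p * \<phi> q"
      using \<phi> M by (intro ballI) blast
    ultimately show "\<phi> \<in> chars"
      unfolding chars_def K_def by (intro CollectI conjI bexI[OF _ pid_UNIV_idem])
  qed
  then have "chars = E (pid UNIV) 1 \<inter> (\<Inter>p\<in>idems. \<Inter>q\<in>idems. M p q)"
    by blast
  moreover have "closedin ?P (\<Inter>p\<in>idems. \<Inter>q\<in>idems. M p q)"
    unfolding M_def using pid_UNIV_idem
    by (intro closedin_INT closedin_Un closedin_Int closed_E idem_comp) blast+
  ultimately show ?thesis
    using closedin_Int[OF closed_E[OF pid_UNIV_idem]] by metis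
qed

lemma compact_space_char_top: "compact_space char_top"
  unfolding char_top_def
  by (intro compact_space_subtopology closedin_compact_space closedin_chars)
    (simp add: compact_space_product_topology compact_space_discrete_topology)

lemma Hausdorff_space_char_top: "Hausdorff_space char_top"
  unfolding char_top_def
  by (intro Hausdorff_space_subtopology)
    (simp add: Hausdorff_space_product_topology Hausdorff_space_discrete_topology)

lemma Omega_subset: "Omega \<subseteq> chars"
  unfolding Omega_def topspace_char_top[symmetric] by (rule closure_of_subset_topspace)

section \<open>Arrows and topology of \<open>GP\<close>\<close>

lemma GP_simps [simp]:
  "rng GP = rng paterson" "src GP = src paterson" "gmult GP = gmult paterson"
  "ginv GP = ginv paterson" "units GP = Omega"
  "gtop GP = subtopology (gtop paterson) (arrows GP)"
  by (simp_all add: GP_def restrict_groupoid_def)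

lemma arrows_paterson: "arrows paterson = {germ g \<phi> | g \<phi>. (g, \<phi>) \<in> germ_pairs}"
  by (auto simp: paterson_def quotient_def germ_def)

lemma arrows_GP_src: "arrows GP = {a \<in> arrows paterson. src paterson a \<in> Omega}"
  by (simp add: GP_def restrict_groupoid_def)

lemma arrows_GP: "arrows GP = {germ g \<phi> | g \<phi>. (g, \<phi>) \<in> germ_pairs \<and> \<phi> \<in> Omega}"
proof (intro equalityI subsetI)
  fix a :: "'a germ" assume "a \<in> arrows GP"
  then obtain g \<phi> where a: "a = germ g \<phi>" "(g, \<phi>) \<in> germ_pairs" "src paterson a \<in> Omega"
    unfolding arrows_GP_src arrows_paterson by blast
  then show "a \<in> {germ g \<phi> | g \<phi>. (g, \<phi>) \<in> germ_pairs \<and> \<phi> \<in> Omega}"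
    using src_germ[OF a(2)] by auto
next
  fix a :: "'a germ" assume "a \<in> {germ g \<phi> | g \<phi>. (g, \<phi>) \<in> germ_pairs \<and> \<phi> \<in> Omega}"
  then obtain g \<phi> where a: "a = germ g \<phi>" "(g, \<phi>) \<in> germ_pairs" "\<phi> \<in> Omega"
    by blast
  then show "a \<in> arrows GP"
    unfolding arrows_GP_src arrows_paterson using src_germ[OF a(2)] by auto
qed

definition source_set :: "'s::left_cancel_monoid pmap \<Rightarrow> 's character set" where
  "source_set g = {\<phi> \<in> chars. \<phi> (pinv g \<circ>\<^sub>m g) = 1}"

lemma source_set_pair: "g \<in> inv_hull \<Longrightarrow> \<phi> \<in> source_set g \<Longrightarrow> (g, \<phi>) \<in> germ_pairs"
  by (simp add: source_set_def germ_pairs_def)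

lemma openin_germ_image:
  assumes "g \<in> inv_hull" "openin char_top U" "U \<subseteq> source_set g"
  shows "openin (gtop paterson) (germ g ` U)"
  unfolding paterson_def groupoid.simps
  using assms by (intro topology_generated_by_Basis) (auto simp: source_set_def)

lemma continuous_map_germ:
  assumes g: "g \<in> inv_hull" and U: "openin char_top U" "U \<subseteq> source_set g"
  shows "continuous_map (subtopology char_top U) (gtop paterson) (germ g)"
  unfolding paterson_def groupoid.simps
proof (rule continuous_on_generated_topo)
  have top: "topspace (subtopology char_top U) = U"
    using openin_subset[OF U(1)] by auto
  show "germ g ` topspace (subtopology char_top U) \<subseteq> \<Union> {germ g ` U |g U. g \<in> inv_hull \<and>
      openin char_top U \<and> U \<subseteq> {\<phi> \<in> chars. \<phi> (pinv g \<circ>\<^sub>m g) = 1}}"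
    using assms unfolding top source_set_def by blast
  fix B :: "'a germ set"
  assume "B \<in> {germ g ` U |g U. g \<in> inv_hull \<and>
      openin char_top U \<and> U \<subseteq> {\<phi> \<in> chars. \<phi> (pinv g \<circ>\<^sub>m g) = 1}}"
  then obtain h W where h: "h \<in> inv_hull" and W: "openin char_top W" "W \<subseteq> source_set h"
    and B: "B = germ h ` W"
    unfolding source_set_def by blast
  define I where "I = {p \<in> idems. g \<circ>\<^sub>m p = h \<circ>\<^sub>m p}"
  have "germ g -` B \<inter> U = (\<Union>p\<in>I. {\<phi> \<in> chars. \<phi> p = 1} \<inter> W \<inter> U)"
  proof (intro equalityI subsetI)
    fix \<phi> assume "\<phi> \<in> germ g -` B \<inter> U"
    then obtain \<psi> where \<phi>: "\<phi> \<in> U" "\<psi> \<in> W" "germ g \<phi> = germ h \<psi>"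
      unfolding B by blast
    have pairs: "(g, \<phi>) \<in> germ_pairs" "(h, \<psi>) \<in> germ_pairs"
      using \<phi> U W g h source_set_pair by blast+
    obtain p where p: "\<phi> = \<psi>" "p \<in> idems" "\<phi> p = 1" "g \<circ>\<^sub>m p = h \<circ>\<^sub>m p"
      using \<phi>(3) pairs by (rule germ_eqE)
    then have "p \<in> I" by (simp add: I_def)
    moreover have "\<phi> \<in> {\<phi> \<in> chars. \<phi> p = 1} \<inter> W \<inter> U"
      using germ_pairsD(2)[OF pairs(1)] p(1,3) \<phi>(1,2) by blast
    ultimately show "\<phi> \<in> (\<Union>p\<in>I. {\<phi> \<in> chars. \<phi> p = 1} \<inter> W \<inter> U)" by blast
  next
    fix \<phi> assume "\<phi> \<in> (\<Union>p\<in>I. {\<phi> \<in> chars. \<phi> p = 1} \<inter> W \<inter> U)"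
    then obtain p where p: "p \<in> idems" "g \<circ>\<^sub>m p = h \<circ>\<^sub>m p" "\<phi> p = 1" and \<phi>: "\<phi> \<in> W" "\<phi> \<in> U"
      unfolding I_def by blast
    have "(g, \<phi>) \<in> germ_pairs" "(h, \<phi>) \<in> germ_pairs"
      using \<phi> U W g h source_set_pair by blast+
    then have "germ g \<phi> = germ h \<phi>"
      using p(1,3,2) by (rule germ_eqI)
    with \<phi> show "\<phi> \<in> germ g -` B \<inter> U"
      unfolding B by blast
  qed
  moreover have "openin char_top (\<Union>p\<in>I. {\<phi> \<in> chars. \<phi> p = 1} \<inter> W \<inter> U)"
    using U(1) W(1) by (intro openin_Union) (auto simp: I_def intro!: openin_Int char_eq_clopen)
  ultimately show "openin (subtopology char_top U) (germ g -` B \<inter> topspace (subtopology char_top U))"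
    unfolding top by (metis inf_le2 openin_subset_topspace_eq openin_open_subtopology U(1))
qed

text \<open>\<open>GP\<close> may fail to be Hausdorff, so separation is checked on \<open>V\<close>
  alone, where the source map is continuous and injective into a Hausdorff space. Compactness is
  inherited from the closed subset \<open>U \<inter> Omega\<close> of the compact space of
  characters.\<close>

lemma germ_image_bisection:
  assumes g: "g \<in> inv_hull" and U: "openin char_top U" "closedin char_top U" "U \<subseteq> source_set g"
  defines "V \<equiv> germ g ` (U \<inter> Omega)"
  shows "openin (gtop GP) V" "Hausdorff_space (subtopology (gtop GP) V)"
    and "compactin (gtop GP) V"
proof -
  have pairs: "\<phi> \<in> U \<Longrightarrow> (g, \<phi>) \<in> germ_pairs" for \<phi>
    using U(3) g source_set_pair by blast
  have V_sub: "V \<subseteq> arrows GP"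
    unfolding V_def arrows_GP using pairs by blast
  \<comment> \<open>A germ determines its source, so intersecting with \<open>arrows GP\<close>
    removes exactly the germs over characters outside \<open>Omega\<close>. This exhibits
    \<open>V\<close> as open in the subspace topology.\<close>
  have "V = germ g ` U \<inter> arrows GP"
  proof -
    have "\<phi> \<in> Omega" if "\<phi> \<in> U" "germ g \<phi> \<in> arrows GP" for \<phi>
    proof -
      obtain h \<psi> where "germ g \<phi> = germ h \<psi>" "(h, \<psi>) \<in> germ_pairs" "\<psi> \<in> Omega"
        using \<open>germ g \<phi> \<in> arrows GP\<close> unfolding arrows_GP by blast
      with src_germ pairs[OF \<open>\<phi> \<in> U\<close>] show ?thesis by metis
    qed
    with V_sub show ?thesis unfolding V_def by blast
  qed
  then show "openin (gtop GP) V"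
    unfolding GP_simps openin_subtopology using openin_germ_image[OF g U(1,3)] by blast
  have "closedin char_top (U \<inter> Omega)"
    using U(2) by (auto simp: Omega_def intro: closedin_Int)
  then have "compactin (subtopology char_top U) (U \<inter> Omega)"
    by (simp add: compactin_subtopology closedin_compact_space compact_space_char_top)
  then have "compactin (gtop paterson) V"
    unfolding V_def by (rule image_compactin[OF _ continuous_map_germ[OF g U(1,3)]])
  then show "compactin (gtop GP) V"
    using V_sub by (simp add: compactin_subtopology)
  have sub: "subtopology (gtop GP) V = subtopology (gtop paterson) V"
    using V_sub by (simp add: subtopology_subtopology Int_absorb1)
  have V_top: "topspace (subtopology (gtop paterson) V) = V"
    using compactin_subset_topspace[OF \<open>compactin (gtop paterson) V\<close>] by auto
  show "Hausdorff_space (subtopology (gtop GP) V)"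
    unfolding sub
  proof (rule Hausdorff_space_injective_preimage[OF Hausdorff_space_char_top])
    have "openin (subtopology (gtop paterson) V) {a \<in> V. src paterson a \<in> W}"
      if W: "openin char_top W" for W
    proof -
      \<comment> \<open>Continuity of the source map: the germs in \<open>V\<close> with source in
        \<open>W\<close> form a basic open set cut down to \<open>V\<close>.\<close>
      have "{a \<in> V. src paterson a \<in> W} = germ g ` (U \<inter> W) \<inter> V"
      proof (intro equalityI subsetI)
        fix a assume "a \<in> {a \<in> V. src paterson a \<in> W}"
        then obtain \<phi> where "\<phi> \<in> U" "a = germ g \<phi>" "src paterson a \<in> W" "a \<in> V"
          unfolding V_def by blast
        then show "a \<in> germ g ` (U \<inter> W) \<inter> V"
          using src_germ[OF pairs] by auto
      next
        fix a assume "a \<in> germ g ` (U \<inter> W) \<inter> V"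
        then show "a \<in> {a \<in> V. src paterson a \<in> W}"
          using src_germ[OF pairs] by auto
      qed
      moreover have "openin (gtop paterson) (germ g ` (U \<inter> W))"
        using U(1,3) W by (intro openin_germ_image[OF g] openin_Int) auto
      ultimately show ?thesis
        unfolding openin_subtopology by blast
    qed
    moreover have "src paterson a \<in> chars" if "a \<in> V" for a
      using that src_germ[OF pairs] Omega_subset unfolding V_def by auto
    ultimately show "continuous_map (subtopology (gtop paterson) V) char_top (src paterson)"
      unfolding continuous_map V_top topspace_char_top by blast
    show "inj_on (src paterson) (topspace (subtopology (gtop paterson) V))"
      unfolding V_top V_def by (rule inj_onI) (auto simp: src_germ[OF pairs])
  qed
qed

section \<open>Indicators of compact open bisections and their differences in
  \<open>Cc\<close>\<close>

lemma indicator_in_Cc_on: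
  assumes "openin (gtop G) V" "compactin (gtop G) V"
  shows "(\<lambda>a. if a \<in> V then 1 else 0) \<in> Cc_on G V"
proof -
  have top: "topspace (subtopology (gtop G) V) = V"
    using openin_subset[OF assms(1)] by auto
  \<comment> \<open>The extension by 0 is invisible inside \<open>V\<close>: there the function is
    the constant 1, and its support is all of \<open>V\<close>, which is compact.\<close>
  have "continuous_map (subtopology (gtop G) V) euclidean (\<lambda>a. if a \<in> V then 1 else (0 :: complex))"
    by (rule continuous_map_eq[of _ _ "\<lambda>_. 1"]) (simp_all add: top)
  moreover have "subtopology (gtop G) V closure_of {a \<in> V. (if a \<in> V then 1 else (0 :: complex)) \<noteq> 0} = V"
    using closure_of_topspace[of "subtopology (gtop G) V"] unfolding top by simp
  ultimately show ?thesis
    using assms(2) by (simp add: Cc_on_def compactin_subtopology)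
qed

lemma Cc_sum:
  assumes "finite F"
    "\<And>f. f \<in> F \<Longrightarrow> \<exists>V. f \<in> Cc_on G V \<and> openin (gtop G) V \<and> Hausdorff_space (subtopology (gtop G) V)"
  shows "(\<lambda>a. \<Sum>f\<in>F. c f * f a) \<in> Cc G"
proof -
  have "F \<subseteq> \<Union>{Cc_on G V | V. openin (gtop G) V \<and> Hausdorff_space (subtopology (gtop G) V)}"
    (is "_ \<subseteq> ?U")
  proof
    fix f assume "f \<in> F"
    then obtain V where V: "f \<in> Cc_on G V" "openin (gtop G) V" "Hausdorff_space (subtopology (gtop G) V)"
      using assms(2) by blast
    then have "Cc_on G V \<in> {Cc_on G V | V. openin (gtop G) V \<and> Hausdorff_space (subtopology (gtop G) V)}"
      by blast
    then show "f \<in> ?U"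
      using V(1) by (rule UnionI)
  qed
  then show ?thesis
    unfolding Cc_def using assms(1)
    by (intro CollectI exI[of _ F] exI[of _ c] conjI refl)
qed

text \<open>The sum in \<open>Cc\<close> runs over a set of functions, so \<open>u\<close> and
  \<open>v\<close> have to be distinct for \<open>{u, v}\<close> to carry the coefficients 1 and
  -1.\<close>

lemma diff_in_Cc:
  assumes V: "openin (gtop G) V" "Hausdorff_space (subtopology (gtop G) V)" "u \<in> Cc_on G V"
    and W: "openin (gtop G) W" "Hausdorff_space (subtopology (gtop G) W)" "v \<in> Cc_on G W"
    and uv: "u \<noteq> v"
  shows "(\<lambda>a. u a - v a) \<in> Cc G"
proof -
  let ?c = "\<lambda>f. if f = u then 1 else - 1 :: complex"
  have sum: "(\<Sum>f\<in>{u, v}. ?c f * f a) = u a - v a" for a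
    using uv by simp
  have "(\<lambda>a. \<Sum>f\<in>{u, v}. ?c f * f a) \<in> Cc G"
  proof (rule Cc_sum)
    fix f assume "f \<in> {u, v}"
    then consider "f = u" | "f = v" by blast
    then show "\<exists>V. f \<in> Cc_on G V \<and> openin (gtop G) V \<and> Hausdorff_space (subtopology (gtop G) V)"
      using V W by cases blast+
  qed simp
  then show ?thesis
    by (simp only: sum)
qed

lemma zero_in_Cc: "(\<lambda>_. 0) \<in> Cc G"
  using Cc_sum[of "{}" G] by simp

section \<open>Faithfulness of the reduced norm\<close>

lemma red_norm_zero_fun: "red_norm G (\<lambda>_. 0) = 0"
proof -
  have "rho G x (\<lambda>_. 0) \<xi> = (\<lambda>_. 0)" for x \<xi>
    by (simp add: rho_def fun_eq_iff)
  then have "rho_norm G x (\<lambda>_. 0) \<le> 0" for x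
    unfolding rho_norm_def by (intro SUP_least) simp
  then have "red_norm G (\<lambda>_. 0) \<le> 0"
    unfolding red_norm_def by (intro SUP_least)
  then show ?thesis by simp
qed

lemma l2norm_indicator: "l2norm (\<lambda>x. if x = t then 1 else 0) \<le> 1"
  unfolding l2norm_def
proof (rule SUP_least)
  fix F :: "'a set" assume "F \<in> {F. finite F}"
  then have "(\<Sum>x\<in>F. (cmod (if x = t then 1 else 0))\<^sup>2) = (\<Sum>x\<in>F. if x = t then 1 else 0)"
    by (intro sum.cong) auto
  also have "\<dots> \<le> 1"
    using \<open>F \<in> _\<close> by simp
  finally show "ennreal (L2_set (\<lambda>x. cmod (if x = t then 1 else 0)) F) \<le> 1"
    unfolding L2_set_def by (simp add: ennreal_le_1)
qed

text \<open>Evaluate the regular representation over the source of \<open>a\<close> at the unit vector of that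
  source: cancellation in the groupoid leaves only the term \<open>f a\<close> of the convolution sum.\<close>

lemma red_norm_eq_0:
  assumes "red_norm GP f = 0" "a \<in> arrows GP"
  shows "f a = 0"
proof -
  obtain g \<phi> where g: "(g, \<phi>) \<in> germ_pairs" and \<phi>: "\<phi> \<in> Omega" and a: "a = germ g \<phi>"
    using assms(2) unfolding arrows_GP by blast
  define c where "c = germ (pinv g \<circ>\<^sub>m g) \<phi>"
  define \<xi> :: "'a germ \<Rightarrow> complex" where "\<xi> = (\<lambda>x. if x = c then 1 else 0)"
  note pair = gmult_ginv_germ(2)[OF g g refl]
  have "c \<in> fibre GP \<phi>"
    using pair \<phi> unfolding fibre_def arrows_GP c_def by (auto simp: src_germ)
  then have "\<xi> \<in> {\<xi>. (\<forall>a. a \<notin> fibre GP \<phi> \<longrightarrow> \<xi> a = 0) \<and> l2norm \<xi> \<le> 1}"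
    using l2norm_indicator by (auto simp: \<xi>_def)
  then have "l2norm (rho GP \<phi> f \<xi>) \<le> rho_norm GP \<phi> f"
    unfolding rho_norm_def by (rule SUP_upper)
  also have "\<dots> \<le> red_norm GP f"
    unfolding red_norm_def using \<phi> by (intro SUP_upper) simp
  finally have "rho GP \<phi> f \<xi> a = 0"
    using assms(1) by (intro l2norm_eq_0) simp
  moreover have "a \<in> fibre GP \<phi>"
    using assms(2) g by (simp add: fibre_def a src_germ)
  ultimately have "(\<Sum>\<^sub>\<infinity>b\<in>{b \<in> arrows GP. rng paterson b = rng paterson a}.
      f b * \<xi> (gmult paterson (ginv paterson b) a)) = 0"
    by (simp add: rho_def)
  also have "(\<Sum>\<^sub>\<infinity>b\<in>{b \<in> arrows GP. rng paterson b = rng paterson a}.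
      f b * \<xi> (gmult paterson (ginv paterson b) a)) = (\<Sum>\<^sub>\<infinity>b\<in>{a}. f b)"
  proof (rule infsum_cong_neutral)
    fix b assume "b \<in> {b \<in> arrows GP. rng paterson b = rng paterson a} - {a}"
    then have b: "b \<in> arrows GP" "rng paterson b = rng paterson a" "b \<noteq> a" by auto
    obtain h \<psi> where h: "(h, \<psi>) \<in> germ_pairs" "b = germ h \<psi>"
      using b(1) unfolding arrows_GP by blast
    have act: "act h \<psi> = act g \<phi>"
      using b(2) rng_germ h g a by metis
    have "gmult paterson (ginv paterson b) a = germ (pinv h \<circ>\<^sub>m g) \<phi>"
      unfolding h(2) a by (rule gmult_ginv_germ(1)[OF h(1) g act])
    also have "\<dots> \<noteq> c"
      using germ_left_cancel[OF h(1) g act] b(3) unfolding c_def h(2) a by blast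
    finally show "f b * \<xi> (gmult paterson (ginv paterson b) a) = 0"
      by (simp add: \<xi>_def)
  next
    fix b assume "b \<in> {b \<in> arrows GP. rng paterson b = rng paterson a} \<inter> {a}"
    then have "b = a" by blast
    moreover have "gmult paterson (ginv paterson a) a = c"
      unfolding a c_def by (rule gmult_ginv_germ(1)[OF g g refl])
    ultimately show "f b * \<xi> (gmult paterson (ginv paterson b) a) = f b"
      by (simp add: \<xi>_def)
  qed (use assms(2) in simp)
  finally show ?thesis by simp
qed

section \<open>The representation at the trivial character\<close>

lemma base_arrow_pair: "(ltrans s, point_char 1) \<in> germ_pairs"
proof -
  have "(1 :: 'a) \<in> dom (pinv (ltrans s) \<circ>\<^sub>m ltrans s)"
    by (simp add: domIff source_comp_apply inv_hull.ltrans) (simp add: ltrans_def)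
  then have "point_char 1 (pinv (ltrans s) \<circ>\<^sub>m ltrans s) = 1"
    by (simp only: point_char_apply source_idem inv_hull.ltrans if_True)
  then show ?thesis
    unfolding germ_pairs_def by (simp only: mem_Collect_eq prod.case point_char_chars inv_hull.ltrans)
qed

lemma rng_base_arrow: "rng paterson (base_arrow s) = point_char s"
  unfolding base_arrow_def rng_germ[OF base_arrow_pair]
  by (rule act_point_char) (simp_all add: inv_hull.ltrans, simp add: ltrans_def)

text \<open>At \<open>base_arrow s\<close> the sum in \<open>rho\<close> runs over the arrows with
  range \<open>point_char s\<close>, so every term vanishes. Off the fibre over \<open>x\<close> the
  value is 0 by convention.\<close>

lemma rho_e_vanishes:
  assumes "\<And>b s. b \<in> arrows GP \<Longrightarrow> rng paterson b = point_char s \<Longrightarrow> f b = 0"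
  shows "rho GP x f \<xi> (base_arrow s) = 0"
proof -
  have "(\<Sum>\<^sub>\<infinity>b\<in>{b \<in> arrows GP. rng paterson b = rng paterson (base_arrow s)}.
      f b * \<xi> (gmult paterson (ginv paterson b) (base_arrow s))) = 0"
    by (rule infsum_0) (use assms in \<open>auto simp: rng_base_arrow\<close>)
  then show ?thesis by (simp add: rho_def)
qed

text \<open>An arrow that ends at a point also starts at one. The range idempotent of
  \<open>g\<close> has the value 1 at \<open>point_char s\<close>, so \<open>s\<close> is the image
  of some \<open>t\<close>, and acting by \<open>pinv g\<close> leads back to
  \<open>point_char t\<close>.\<close>

lemma point_char_preimage:
  assumes g: "(g, \<psi>) \<in> germ_pairs" and s: "act g \<psi> = point_char s"
  obtains t where "g t = Some s" "\<psi> = point_char t"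
proof -
  note D = germ_pairsD[OF g]
  have "point_char s (g \<circ>\<^sub>m pinv g) = 1"
    using act_range_idem[OF g] by (simp only: s)
  then have "s \<in> dom (g \<circ>\<^sub>m pinv g)"
    by (simp add: point_char_apply range_idem D split: if_splits)
  then obtain t where t: "pinv g s = Some t"
    by (auto simp: map_comp_def split: option.splits)
  then have "\<psi> = point_char t"
    using act_pinv_act[OF g] act_point_char[OF inv_hull.pinv[OF D(1)] t] by (simp add: s)
  with t that show ?thesis
    by (simp add: pinv_Some D)
qed

text \<open>Equivariance spreads the equality at \<open>t\<close> over \<open>tS\<close>, and the
  partial identity on \<open>tS\<close> has the value 1 at \<open>point_char t\<close>.\<close>

lemma germ_point_char_eq:
  assumes g: "(g, point_char t) \<in> germ_pairs" and h: "(h, point_char t) \<in> germ_pairs"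
    and gh: "g t = h t"
  shows "germ g (point_char t) = germ h (point_char t)"
proof (rule germ_eqI[OF g h])
  let ?p = "ltrans t \<circ>\<^sub>m pinv (ltrans t)"
  note D = germ_pairsD[OF g] and D' = germ_pairsD[OF h]
  show p: "?p \<in> idems"
    by (rule range_idem[OF inv_hull.ltrans])
  have p_Some: "?p x = Some y \<longleftrightarrow> (\<exists>z. x = t * z) \<and> y = x" for x y
    unfolding map_comp_Some pinv_Some[OF inv_hull.ltrans] by (auto simp: ltrans_def)
  have "?p t = Some t"
    unfolding p_Some by (metis mult_1_right)
  then show "point_char t ?p = 1"
    using p by (auto simp: point_char_apply)
  have "t \<in> dom (pinv g \<circ>\<^sub>m g)"
    using D by (simp add: point_char_apply source_idem split: if_splits)
  then obtain u where u: "g t = Some u"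
    by (auto simp: map_comp_def split: option.splits)
  have "g (t * z) = h (t * z)" for z
    using inv_hull_equivariant[OF D(1) u, of z] inv_hull_equivariant[OF D'(1), of t u z] gh u
    by simp
  then show "g \<circ>\<^sub>m ?p = h \<circ>\<^sub>m ?p"
    by (intro pmap_eqI) (auto simp: map_comp_Some[of _ ?p] p_Some)
qed

section \<open>Passage to the completion and use of the isomorphism\<close>

lemma const_in_red_Cauchy: "f \<in> Cc G \<Longrightarrow> (\<lambda>_. f) \<in> red_Cauchy G"
  unfolding red_Cauchy_def by (simp add: red_norm_zero_fun)

text \<open>The class of 0 contains the zero sequence, so the constant sequence \<open>f\<close> is
  related to it. A constant sequence of norms that tends to 0 is 0.\<close>

lemma Cc_embed_eqD:
  assumes "f \<in> Cc G" "Cc_embed G f = Cc_embed G (\<lambda>_. 0)"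
  shows "red_norm G f = 0"
proof -
  have "((\<lambda>_. \<lambda>_. 0), (\<lambda>_. \<lambda>_. 0)) \<in> red_rel G"
    unfolding red_rel_def by (simp add: const_in_red_Cauchy zero_in_Cc red_norm_zero_fun)
  then have "(\<lambda>_. \<lambda>_. 0) \<in> Cc_embed G f"
    unfolding assms(2) by (simp add: Cc_embed_def)
  then have "(\<lambda>_ :: nat. red_norm G f) \<longlonglongrightarrow> 0"
    by (simp add: Cc_embed_def red_rel_def)
  then show ?thesis
    by (simp add: LIMSEQ_const_iff)
qed

text \<open>\<open>is_rho_e\<close> prescribes every coordinate of every vector in the image of the
  operator, so the values of \<open>rho\<close> at base arrows determine it.\<close>

lemma is_rho_e_unique:
  assumes "is_rho_e f T" "is_rho_e h R"
    and "\<And>\<xi> s. rho GP (point_char 1) f \<xi> (base_arrow s) = rho GP (point_char 1) h \<xi> (base_arrow s)"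
  shows "T = R"
proof (rule blinfun_eqI)
  fix \<xi>
  have "ell2_fun (blinfun_apply T \<xi>) = ell2_fun (blinfun_apply R \<xi>)"
    using assms unfolding is_rho_e_def by (intro ext) simp
  then show "blinfun_apply T \<xi> = blinfun_apply R \<xi>"
    by (simp only: ell2_fun_inject)
qed

text \<open>Here injectivity of \<Phi> enters: \<open>f\<close> and 0 yield the same operator, hence
  the same class in the completion. So \<open>f\<close> has reduced norm 0, and
  \<open>red_norm_eq_0\<close> makes it vanish at every arrow.\<close>

lemma star_iso_rho_e_faithful:
  fixes f :: "'s::left_cancel_monoid germ \<Rightarrow> complex"
  assumes iso: "star_iso (Cstar_red (GP :: ('s germ, 's character) groupoid)) (Cstar_monoid :: 's op star_algebra) \<Phi>"
    and \<Phi>: "\<forall>f\<in>Cc GP. is_rho_e f (\<Phi> (Cc_embed GP f))"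
    and f: "f \<in> Cc GP"
    and vanish: "\<And>b s. b \<in> arrows GP \<Longrightarrow> rng paterson b = point_char s \<Longrightarrow> f b = 0"
    and a: "a \<in> arrows GP"
  shows "f a = 0"
proof -
  have "\<Phi> (Cc_embed GP f) = \<Phi> (Cc_embed GP (\<lambda>_. 0))"
  proof (rule is_rho_e_unique)
    show "is_rho_e f (\<Phi> (Cc_embed GP f))" "is_rho_e (\<lambda>_. 0) (\<Phi> (Cc_embed GP (\<lambda>_. 0)))"
      using \<Phi> f zero_in_Cc by blast+
    fix \<xi> and s :: 's
    have "rho GP (point_char 1) f \<xi> (base_arrow s) = 0"
      by (rule rho_e_vanishes) (rule vanish)
    also have "0 = rho GP (point_char 1) (\<lambda>_. 0) \<xi> (base_arrow s)"
      by (rule rho_e_vanishes[symmetric]) simp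
    finally show "rho GP (point_char 1) f \<xi> (base_arrow s)
        = rho GP (point_char 1) (\<lambda>_. 0) \<xi> (base_arrow s)" .
  qed
  moreover have "inj_on \<Phi> (scarrier (Cstar_red (GP :: ('s germ, 's character) groupoid)))"
    using iso unfolding star_iso_def by (blast dest: bij_betw_imp_inj_on)
  moreover have "Cc_embed GP h \<in> scarrier (Cstar_red (GP :: ('s germ, 's character) groupoid))"
    if "h \<in> Cc GP" for h
    unfolding Cc_embed_def Cstar_red_def star_algebra.simps
    by (intro quotientI const_in_red_Cauchy that)
  ultimately have "Cc_embed GP f = Cc_embed GP (\<lambda>_. 0)"
    using f zero_in_Cc by (blast dest: inj_onD)
  then have "red_norm GP f = 0"
    by (rule Cc_embed_eqD[OF f])
  then show ?thesis
    using a by (rule red_norm_eq_0)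
qed

text \<open>Each single condition is clopen, and finiteness of the family keeps the intersection
  open.\<close>

lemma char_vanish_clopen:
  assumes "finite \<F>" "\<F> \<subseteq> constr_ideals"
  shows "openin char_top {\<phi> \<in> chars. \<forall>Z\<in>\<F>. \<phi> (pid Z) = 0}
    \<and> closedin char_top {\<phi> \<in> chars. \<forall>Z\<in>\<F>. \<phi> (pid Z) = 0}"
  using assms
proof (induction rule: finite_induct)
  case empty
  show ?case
    using openin_topspace[of char_top] closedin_topspace[of char_top] by (simp add: topspace_char_top)
next
  case (insert Z \<F>)
  then have Z: "pid Z \<in> idems" and "\<F> \<subseteq> constr_ideals"
    using constr_ideal_idem by blast+
  have "{\<phi> \<in> chars. \<forall>Z\<in>insert Z \<F>. \<phi> (pid Z) = 0}
      = {\<phi> \<in> chars. \<phi> (pid Z) = 0} \<inter> {\<phi> \<in> chars. \<forall>Z\<in>\<F>. \<phi> (pid Z) = 0}"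
    by (rule set_eqI) (simp only: mem_Collect_eq Int_iff ball_simps(7), fast)
  then show ?case
    using insert.IH[OF \<open>\<F> \<subseteq> constr_ideals\<close>] char_eq_clopen[OF Z, of 0]
    by (simp only: openin_Int closedin_Int simp_thms)
qed

text \<open>The difference set is given by \<open>X\<close> and a finite family that may be empty,
  which covers both clauses of \<open>constr_diffs\<close>.\<close>

lemma germ_eq_if_agree_on_diff:
  assumes iso: "star_iso (Cstar_red (GP :: ('s::left_cancel_monoid germ, 's character) groupoid))
      (Cstar_monoid :: 's op star_algebra) \<Phi>"
    and \<Phi>: "\<forall>f\<in>Cc GP. is_rho_e f (\<Phi> (Cc_embed GP f))"
    and g: "(g, \<phi>) \<in> germ_pairs" and h: "(h, \<phi>) \<in> germ_pairs" and \<phi>: "\<phi> \<in> Omega"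
    and X: "X \<in> constr_ideals" "\<phi> (pid X) = 1"
    and F: "finite \<F>" "\<F> \<subseteq> constr_ideals" "\<forall>Z\<in>\<F>. \<phi> (pid Z) = 0"
    and agree: "g |` (X - \<Union>\<F>) = h |` (X - \<Union>\<F>)"
  shows "germ g (\<phi> :: 's character) = germ h \<phi>"
proof (rule ccontr)
  assume neq: "germ g \<phi> \<noteq> germ h \<phi>"
  note D = germ_pairsD[OF g] and D' = germ_pairsD[OF h]
  \<comment> \<open>Both source sets enter, so that the bisections of \<open>g\<close> and of
    \<open>h\<close> lie over the same set; all four factors are clopen.\<close>
  define U where "U = source_set g \<inter> source_set h \<inter> {\<phi> \<in> chars. \<phi> (pid X) = 1}
      \<inter> {\<phi> \<in> chars. \<forall>Z\<in>\<F>. \<phi> (pid Z) = 0}"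
  have U: "openin char_top U" "closedin char_top U"
    unfolding U_def source_set_def
    using char_vanish_clopen[OF F(1,2)]
    by (auto intro!: openin_Int closedin_Int char_eq_clopen source_idem constr_ideal_idem D(1) D'(1) X(1))
  have \<phi>U: "\<phi> \<in> U"
    unfolding U_def source_set_def using D D' X(2) F(3) by blast
  have U_sub: "U \<subseteq> source_set g" "U \<subseteq> source_set h"
    unfolding U_def by blast+
  have pairs: "(g, \<psi>) \<in> germ_pairs" "(h, \<psi>) \<in> germ_pairs" if "\<psi> \<in> U" for \<psi>
    using that U_sub source_set_pair[OF D(1)] source_set_pair[OF D'(1)] by blast+
  have collapse: "germ g (point_char t) = germ h (point_char t)" if t: "point_char t \<in> U" for t
  proof (rule germ_point_char_eq[OF pairs[OF t]])
    \<comment> \<open>Read at the idempotents of \<open>X\<close> and of the family, membership of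
      \<open>point_char t\<close> in \<open>U\<close> places \<open>t\<close> itself in the
      difference set.\<close>
    have "point_char t (pid X) = 1" "\<And>Z. Z \<in> \<F> \<Longrightarrow> point_char t (pid Z) = 0"
      using t unfolding U_def by blast+
    moreover have "point_char t (pid Z) = (if t \<in> Z then 1 else 0)" if "Z \<in> constr_ideals" for Z
      using point_char_apply[OF constr_ideal_idem[OF that]] by (simp only: dom_pid)
    ultimately have "t \<in> X" "\<And>Z. Z \<in> \<F> \<Longrightarrow> t \<notin> Z"
      using X(1) F(2) by (metis zero_neq_one, metis subsetD zero_neq_one)
    then have "t \<in> X - \<Union>\<F>" by blast
    then show "g t = h t"
      using fun_cong[OF agree, of t] by simp
  qed
  define V W where "V = germ g ` (U \<inter> Omega)" and "W = germ h ` (U \<inter> Omega)"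
  define u v :: "'s germ \<Rightarrow> complex"
    where "u = (\<lambda>a. if a \<in> V then 1 else 0)" and "v = (\<lambda>a. if a \<in> W then 1 else 0)"
  note V = germ_image_bisection[OF D(1) U U_sub(1), folded V_def]
  note W = germ_image_bisection[OF D'(1) U U_sub(2), folded W_def]
  have "germ g \<phi> \<in> V"
    unfolding V_def using \<phi>U \<phi> by blast
  \<comment> \<open>Equal germs have equal sources, so an element of \<open>W\<close> equal to
    \<open>germ g \<phi>\<close> could only be \<open>germ h \<phi>\<close>.\<close>
  have "germ g \<phi> \<notin> W"
  proof
    assume "germ g \<phi> \<in> W"
    then obtain \<psi> where \<psi>: "germ g \<phi> = germ h \<psi>" "\<psi> \<in> U"
      unfolding W_def by blast
    obtain p where "\<phi> = \<psi>"
      using \<psi>(1) g pairs(2)[OF \<psi>(2)] by (rule germ_eqE)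
    with neq \<psi>(1) show False by blast
  qed
  with \<open>germ g \<phi> \<in> V\<close> have one: "u (germ g \<phi>) - v (germ g \<phi>) = 1"
    by (simp add: u_def v_def)
  then have "u \<noteq> v" by auto
  have "u \<in> Cc_on GP V" "v \<in> Cc_on GP W"
    unfolding u_def v_def by (rule indicator_in_Cc_on[OF V(1,3)], rule indicator_in_Cc_on[OF W(1,3)])
  then have Cc: "(\<lambda>a. u a - v a) \<in> Cc GP"
    using diff_in_Cc[OF V(1,2) _ W(1,2) _ \<open>u \<noteq> v\<close>] by blast
  have "u (germ g \<phi>) - v (germ g \<phi>) = 0"
  proof (rule star_iso_rho_e_faithful[OF iso \<Phi> Cc])
    show "germ g \<phi> \<in> arrows GP"
      unfolding arrows_GP using g \<phi> by blast
    fix b :: "'s germ" and s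
    assume b: "rng paterson b = point_char s"
    \<comment> \<open>By \<open>point_char_preimage\<close> the source of such an arrow is again a
      point character. It lies in \<open>U\<close>, where \<open>collapse\<close> identifies the
      germs of \<open>g\<close> and \<open>h\<close>.\<close>
    have "b \<in> V \<longleftrightarrow> b \<in> W"
    proof
      assume "b \<in> V"
      then obtain \<psi> where \<psi>: "b = germ g \<psi>" "\<psi> \<in> U" "\<psi> \<in> Omega"
        unfolding V_def by blast
      then have "act g \<psi> = point_char s"
        using b rng_germ[OF pairs(1)[OF \<psi>(2)]] by metis
      then obtain t where "\<psi> = point_char t"
        using point_char_preimage[OF pairs(1)[OF \<psi>(2)]] by blast
      with \<psi> collapse show "b \<in> W"
        unfolding W_def by blast
    next
      assume "b \<in> W"
      then obtain \<psi> where \<psi>: "b = germ h \<psi>" "\<psi> \<in> U" "\<psi> \<in> Omega"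
        unfolding W_def by blast
      then have "act h \<psi> = point_char s"
        using b rng_germ[OF pairs(2)[OF \<psi>(2)]] by metis
      then obtain t where "\<psi> = point_char t"
        using point_char_preimage[OF pairs(2)[OF \<psi>(2)]] by blast
      with \<psi> collapse[symmetric] show "b \<in> V"
        unfolding V_def by blast
    qed
    then show "u b - v b = 0"
      by (simp add: u_def v_def)
  qed
  with one show False by simp
qed

theorem proposition2p13:
  assumes "\<exists>\<Phi>. star_iso (Cstar_red (GP :: ('s::left_cancel_monoid germ, 's character) groupoid))
                 (Cstar_monoid :: 's op star_algebra) \<Phi> \<and>
               (\<forall>f\<in>Cc GP. is_rho_e f (\<Phi> (Cc_embed GP f)))"
  shows "(GP_sim :: ('s germ \<times> 's germ) set) = Id_on (arrows GP)"
proof (intro equalityI subsetI)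
  obtain \<Phi> where iso: "star_iso (Cstar_red (GP :: ('s germ, 's character) groupoid))
      (Cstar_monoid :: 's op star_algebra) \<Phi>"
    and \<Phi>: "\<forall>f\<in>Cc GP. is_rho_e f (\<Phi> (Cc_embed GP f))"
    using assms by blast
  fix ab :: "'s germ \<times> 's germ" assume "ab \<in> GP_sim"
  then obtain g h \<phi> Y where ab: "ab = (germ g \<phi>, germ h \<phi>)" and arr: "germ g \<phi> \<in> arrows GP"
    and g: "(g, \<phi>) \<in> germ_pairs" and h: "(h, \<phi>) \<in> germ_pairs"
    and Y: "char_ext \<phi> Y = 1" "g |` Y = h |` Y"
    unfolding GP_sim_def by blast
  have \<phi>: "\<phi> \<in> Omega"
    using arr unfolding arrows_GP_src by (simp add: src_germ[OF g])
  \<comment> \<open>The default value of \<open>char_ext\<close> is 0, so the value 1 provides a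
    presentation of \<open>Y\<close> of the required kind.\<close>
  have "\<exists>X \<F>. X \<in> constr_ideals \<and> finite \<F> \<and> \<F> \<subseteq> constr_ideals \<and>
      Y = X - \<Union>\<F> \<and> \<phi> (pid X) = 1 \<and> (\<forall>Z\<in>\<F>. \<phi> (pid Z) = 0)"
    using Y(1) unfolding char_ext_def by (metis zero_neq_one)
  then obtain X \<F> where X: "X \<in> constr_ideals" "\<phi> (pid X) = 1"
    and F: "finite \<F>" "\<F> \<subseteq> constr_ideals" "\<forall>Z\<in>\<F>. \<phi> (pid Z) = 0" and Y_eq: "Y = X - \<Union>\<F>"
    by blast
  have "germ g \<phi> = germ h \<phi>"
    by (rule germ_eq_if_agree_on_diff[OF iso \<Phi> g h \<phi> X F Y(2)[unfolded Y_eq]])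
  with arr show "ab \<in> Id_on (arrows GP)"
    unfolding ab by auto
next
  fix ab :: "'s germ \<times> 's germ" assume "ab \<in> Id_on (arrows GP)"
  then obtain a where a: "a \<in> arrows GP" "ab = (a, a)"
    by (rule Id_onE)
  then obtain g \<phi> where g: "(g, \<phi>) \<in> germ_pairs" "a = germ g \<phi>"
    unfolding arrows_GP by blast
  \<comment> \<open>Reflexivity: every arrow is related to itself through the whole monoid,
    presented as a difference with the empty family.\<close>
  have "UNIV = UNIV - \<Union>{}" "\<phi> (pid UNIV) = 1"
    using char_one[OF germ_pairsD(2)[OF g(1)]] by simp_all
  then have "\<exists>X \<F>. X \<in> constr_ideals \<and> finite \<F> \<and> \<F> \<subseteq> constr_ideals \<and>
      UNIV = X - \<Union>\<F> \<and> \<phi> (pid X) = 1 \<and> (\<forall>Z\<in>\<F>. \<phi> (pid Z) = 0)"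
    using constr_ideals.whole
    by (intro exI[of _ UNIV] exI[of _ "{}"] conjI finite.emptyI empty_subsetI) simp_all
  then have "char_ext \<phi> UNIV = 1"
    unfolding char_ext_def by (simp only: if_True)
  moreover have "UNIV \<in> (constr_diffs :: 's set set)"
    unfolding constr_diffs_def using constr_ideals.whole by blast
  ultimately show "ab \<in> GP_sim"
    using a g unfolding GP_sim_def by blast
qed

end
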